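(* Let $n\ge 0$ and $d\geq 1$ be integers, let $\mathcal{F}$ be an $n$-cover, and let $\leq_1,\dots,\leq_d$ be $d$ linear orders on $\mathcal{F}$. Then there is $u\in\mathbb{S}^n$ witnessing an alternating pattern of length at least $\left(\frac{n+1}{2}\right)^{1/2^{d-1}}$ that is monotone with respect to all $d$ orders. That is, there are $u\in\mathbb{S}^n$, an integer $k\geq\left(\frac{n+1}{2}\right)^{1/2^{d-1}}$, and $F_1,\dots,F_k\in\mathcal{F}$ such that: (1) either $u\in(-1)^{i-1}F_i$ for all $i=1,\dots,k$, or $u\in(-1)^{i}F_i$ for all $i=1,\dots,k$; (2) for each $j\in\{1,\dots,d\}$, either $F_1\leq_j F_2\leq_j\dots\leq_j F_k$ or $F_1\geq_j F_2\geq_j\dots\geq_j F_k$. Moreover, this is asymptotically sharp in the following sense: for all such $n$ and $d$ there are an $n$-cover $\mathcal{F}$ and $d$ linear orders $\leq_1,\dots,\leq_d$ on $\mathcal{F}$ such that, whenever $u\in\mathbb{S}^n$, $k\ge 1$ and $F_1,\dots,F_k\in\mathcal{F}$ satisfy (1) and (2), one has $k\leq\left\lceil (n+2)^{D}\right\rceil$, where $D=1/2^{d-1}$.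
   Context: $\mathbb{S}^n$ is the unit sphere in $\mathbb{R}^{n+1}$, with antipodal map $u\mapsto -u$. For $F\subseteq\mathbb{S}^n$, $-F=\{-u : u\in F\}$, $(+1)F=F$ and $(-1)F=-F$. A set $F\subseteq \mathbb{S}^n$ is antipodal-free if $F\cap(-F)=\emptyset$. An $n$-cover is a finite family $\mathcal{F}$ of closed antipodal-free subsets of $\mathbb{S}^n$ whose union is $\mathbb{S}^n$. *)

theory Defs
  imports "HOL-Analysis.Analysis"
begin

(* The sphere S^n is nsphere n: points are the functions u :: nat => real that vanish above
   index n and satisfy u 0 ^ 2 + ... + u n ^ 2 = 1.  The antipodal map is the pointwise uminus. *)

definition antipodal_free :: "(nat \<Rightarrow> real) set \<Rightarrow> bool" where
  "antipodal_free F \<longleftrightarrow> F \<inter> uminus ` F = {}"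

definition n_cover :: "nat \<Rightarrow> (nat \<Rightarrow> real) set set \<Rightarrow> bool" where
  "n_cover n \<F> \<longleftrightarrow>
     finite \<F> \<and>
     (\<forall>F\<in>\<F>. closedin (nsphere n) F \<and> antipodal_free F) \<and>
     \<Union>\<F> = topspace (nsphere n)"

definition signed :: "real \<Rightarrow> (nat \<Rightarrow> real) set \<Rightarrow> (nat \<Rightarrow> real) set" where
  "signed s F = (\<lambda>u i. s * u i) ` F"

lemma signed_1: "signed 1 F = F"
  by (simp add: signed_def)

lemma signed_minus_1: "signed (- 1) F = uminus ` F"
  by (simp add: signed_def fun_Compl_def)

definition alternating_at :: "(nat \<Rightarrow> real) \<Rightarrow> nat \<Rightarrow> (nat \<Rightarrow> (nat \<Rightarrow> real) set) \<Rightarrow> bool" where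
  "alternating_at u k F \<longleftrightarrow>
     (\<forall>i\<in>{1..k}. u \<in> signed ((- 1) ^ (i - 1)) (F i)) \<or>
     (\<forall>i\<in>{1..k}. u \<in> signed ((- 1) ^ i) (F i))"

definition monotone_wrt :: "'a rel \<Rightarrow> nat \<Rightarrow> (nat \<Rightarrow> 'a) \<Rightarrow> bool" where
  "monotone_wrt r k F \<longleftrightarrow>
     (\<forall>i\<in>{1..<k}. (F i, F (i + 1)) \<in> r) \<or>
     (\<forall>i\<in>{1..<k}. (F (i + 1), F i) \<in> r)"

end

theory Submission
  imports Defs "HOL-Homology.Homology"
begin

text \<open>
  Lower bound. Refine the first order into \<open>M = 2 ^ (d - 1)\<close> relations, one for each choice of
  agreement or disagreement with the other orders; any two members of the cover are comparable
  in one of them. To a pair \<open>(A, B)\<close> of disjoint families assign the tuple of lengths of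
  longest alternating chains, where each relation is only examined on the starting points of longest
  chains for the previous ones. This tuple, together with a sign that it determines along
  nested pairs, takes at most \<open>k ^ M\<close> values up to sign when all monotone patterns have length at most \<open>k\<close>.
  Products of truncated differences of distances to the cover turn it into an odd nowhere vanishing map
  from the \<open>n\<close>-sphere to \<open>k ^ M\<close>-space, so \<open>k ^ M \<ge> n + 1\<close> by the Borsuk--Ulam theorem.

  The map is Lipschitz, so only the Lipschitz case of Borsuk--Ulam is needed. It follows from the
  degree step between a sphere and its equator in the homology library. An
  odd Lipschitz map can be deformed to preserve the equator because its restriction to the equator
  misses a line.

  Sharpness. The \<open>n + 1\<close> caps \<open>u i \<ge> c\<close> and the remaining set \<open>u i \<le> c\<close> for all \<open>i\<close> form a cover with
  \<open>n + 2\<close> members; order them by a lexicographic construction of Erdos--Szekeres type.\<close>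

section \<open>Lipschitz functions on spheres\<close>

lemma topspace_nsphere:
  "topspace (nsphere n) = {x. (\<Sum>i\<le>n. (x i)\<^sup>2) = 1 \<and> (\<forall>i>n. x i = 0)}"
  by (simp add: nsphere)

lemma nsphere_eq_top_of_set: "nsphere n = top_of_set (topspace (nsphere n))"
  by (simp add: nsphere euclidean_product_topology)

lemma uminus_in_nsphere [simp]: "- x \<in> topspace (nsphere n) \<longleftrightarrow> x \<in> topspace (nsphere n)"
  by (simp add: topspace_nsphere)

lemma nsphere_mono: "m \<le> n \<Longrightarrow> topspace (nsphere m) \<subseteq> topspace (nsphere n)"
proof -
  assume "m \<le> n"
  have "(\<Sum>i\<le>n. (x i)\<^sup>2) = (\<Sum>i\<le>m. (x i)\<^sup>2)" if "\<forall>i>m. x i = 0" for x :: "nat \<Rightarrow> real"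
    using that \<open>m \<le> n\<close> by (intro sum.mono_neutral_right) auto
  then show ?thesis using \<open>m \<le> n\<close> by (auto simp: topspace_nsphere)
qed

lemma nsphere_coord_le_1:
  assumes "x \<in> topspace (nsphere n)" shows "\<bar>x i\<bar> \<le> 1"
proof (cases "i \<le> n")
  case True
  then have "(x i)\<^sup>2 \<le> (\<Sum>i\<le>n. (x i)\<^sup>2)" by (intro member_le_sum) auto
  then show ?thesis using assms by (simp add: topspace_nsphere abs_square_le_1)
qed (use assms in \<open>simp add: topspace_nsphere\<close>)

text \<open>Points are infinite sequences, so compactness comes from Tychonoff: the sphere is closed
  in the cube of sequences with entries in [-1, 1].\<close>

lemma compact_nsphere: "compact (topspace (nsphere n))"
proof -
  have "compact (PiE (UNIV :: nat set) (\<lambda>_. {-1..1::real}))"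
    using compactin_PiE[of "\<lambda>_. euclideanreal" UNIV "\<lambda>_. {-1..1}"]
    by (simp add: euclidean_product_topology)
  moreover have "closed (topspace (nsphere n))"
  proof -
    have "topspace (nsphere n) = {x. (\<Sum>i\<le>n. (x i)\<^sup>2) = 1} \<inter> (\<Inter>i\<in>{n<..}. {x. x i = 0})"
      by (auto simp: topspace_nsphere)
    also have "closed \<dots>"
      by (intro closed_Int closed_INT ballI closed_Collect_eq continuous_intros
          continuous_on_product_coordinates)
    finally show ?thesis .
  qed
  moreover have "topspace (nsphere n) \<subseteq> PiE UNIV (\<lambda>_. {-1..1})"
    using nsphere_coord_le_1 by (fastforce simp: abs_le_iff)
  ultimately show ?thesis
    by (metis compact_Int_closed inf.absorb_iff2)
qed

lemma continuous_map_nsphere_real: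
  "continuous_map (nsphere n) euclideanreal f \<longleftrightarrow> continuous_on (topspace (nsphere n)) f"
  by (metis nsphere_eq_top_of_set continuous_map_iff_continuous)

section \<open>The l1 metric and Lipschitz functions\<close>

definition l1_dist :: "nat \<Rightarrow> (nat \<Rightarrow> real) \<Rightarrow> (nat \<Rightarrow> real) \<Rightarrow> real" where
  "l1_dist n x y = (\<Sum>j\<le>n. \<bar>x j - y j\<bar>)"

lemma l1_dist_nonneg [simp]: "0 \<le> l1_dist n x y"
  by (simp add: l1_dist_def sum_nonneg)

lemma l1_dist_uminus [simp]: "l1_dist n (- x) (- y) = l1_dist n x y"
  by (simp add: l1_dist_def abs_minus_commute)

lemma l1_dist_commute: "l1_dist n x y = l1_dist n y x"
  by (simp add: l1_dist_def abs_minus_commute)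

lemma l1_dist_triangle: "l1_dist n x z \<le> l1_dist n x y + l1_dist n y z"
  unfolding l1_dist_def sum.distrib[symmetric] by (intro sum_mono) linarith

lemma l1_dist_eq_0:
  assumes "x \<in> topspace (nsphere n)" "y \<in> topspace (nsphere n)" "l1_dist n x y = 0"
  shows "x = y"
proof
  fix i show "x i = y i"
    using assms by (cases "i \<le> n") (auto simp: l1_dist_def topspace_nsphere sum_nonneg_eq_0_iff)
qed

lemma continuous_on_l1_dist: "continuous_on A (l1_dist n x)"
  unfolding l1_dist_def[abs_def]
  by (intro continuous_intros continuous_on_subset[OF continuous_on_product_coordinates]) auto

definition nsphere_lipschitz :: "nat \<Rightarrow> ((nat \<Rightarrow> real) \<Rightarrow> real) \<Rightarrow> bool" where
  "nsphere_lipschitz n f \<longleftrightarrow>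
     (\<exists>K\<ge>0. \<forall>x\<in>topspace (nsphere n). \<forall>y\<in>topspace (nsphere n). \<bar>f x - f y\<bar> \<le> K * l1_dist n x y)"

lemma nsphere_lipschitzI:
  assumes "K \<ge> 0"
    and "\<And>x y. x \<in> topspace (nsphere n) \<Longrightarrow> y \<in> topspace (nsphere n) \<Longrightarrow> \<bar>f x - f y\<bar> \<le> K * l1_dist n x y"
  shows "nsphere_lipschitz n f"
  using assms unfolding nsphere_lipschitz_def by blast

lemma nsphere_lipschitzE:
  assumes "nsphere_lipschitz n f"
  obtains K where "K \<ge> 0"
    "\<And>x y. x \<in> topspace (nsphere n) \<Longrightarrow> y \<in> topspace (nsphere n) \<Longrightarrow> \<bar>f x - f y\<bar> \<le> K * l1_dist n x y"
  using assms unfolding nsphere_lipschitz_def by blast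

text \<open>The ambient topology is the product topology, so continuity at \<open>x\<close> is
  squeezed out of \<open>K * l1_dist n x y\<close>, which is continuous in \<open>y\<close> for that
  topology and vanishes at \<open>x\<close>.\<close>

lemma nsphere_lipschitz_imp_continuous:
  assumes "nsphere_lipschitz n f" shows "continuous_on (topspace (nsphere n)) f"
proof -
  obtain K where K: "\<And>x y. x \<in> topspace (nsphere n) \<Longrightarrow> y \<in> topspace (nsphere n)
      \<Longrightarrow> \<bar>f x - f y\<bar> \<le> K * l1_dist n x y"
    using assms by (rule nsphere_lipschitzE) blast
  show ?thesis unfolding continuous_on_def
  proof
    fix x assume x: "x \<in> topspace (nsphere n)"
    have "continuous_on (topspace (nsphere n)) (\<lambda>y. K * l1_dist n x y)"
      by (intro continuous_intros continuous_on_l1_dist)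
    then have "((\<lambda>y. K * l1_dist n x y) \<longlongrightarrow> K * l1_dist n x x) (at x within topspace (nsphere n))"
      using x by (auto simp: continuous_on_def)
    then have "((\<lambda>y. K * l1_dist n x y) \<longlongrightarrow> 0) (at x within topspace (nsphere n))"
      by (simp add: l1_dist_def)
    then have "((\<lambda>y. f y - f x) \<longlongrightarrow> 0) (at x within topspace (nsphere n))"
      by (rule Lim_null_comparison[rotated])
         (use K[OF x] in \<open>auto simp: eventually_at_filter abs_minus_commute intro!: always_eventually\<close>)
    then show "(f \<longlongrightarrow> f x) (at x within topspace (nsphere n))"
      using Lim_null by blast
  qed
qed

lemma nsphere_lipschitz_bounded:
  assumes "nsphere_lipschitz n f"
  obtains M where "M \<ge> 0" "\<And>x. x \<in> topspace (nsphere n) \<Longrightarrow> \<bar>f x\<bar> \<le> M"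
proof -
  have "bounded (f ` topspace (nsphere n))"
    using compact_continuous_image[OF nsphere_lipschitz_imp_continuous[OF assms] compact_nsphere]
    by (rule compact_imp_bounded)
  then obtain M where "M > 0" "\<forall>x\<in>topspace (nsphere n). \<bar>f x\<bar> \<le> M"
    by (auto simp: bounded_pos)
  then show ?thesis using that[of M] by auto
qed

lemma nsphere_pos_lower_bound:
  assumes "continuous_on (topspace (nsphere n)) f" "\<And>x. x \<in> topspace (nsphere n) \<Longrightarrow> 0 < f x"
  shows "\<exists>m>0. \<forall>x\<in>topspace (nsphere n). m \<le> (f x :: real)"
proof -
  have ne: "topspace (nsphere n) \<noteq> {}" using in_topspace_nsphere by blast
  obtain z where "z \<in> topspace (nsphere n)" "\<And>x. x \<in> topspace (nsphere n) \<Longrightarrow> f z \<le> f x"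
    using continuous_attains_inf[OF compact_nsphere ne assms(1)] by blast
  then show ?thesis using assms(2) by blast
qed

section \<open>Closure rules for Lipschitz functions\<close>

named_theorems lip_intros

lemma nsphere_lipschitz_const [lip_intros]: "nsphere_lipschitz n (\<lambda>x. c)"
  by (rule nsphere_lipschitzI[of 0]) auto

lemma nsphere_lipschitz_coord [lip_intros]: "nsphere_lipschitz n (\<lambda>x. x i)"
proof (rule nsphere_lipschitzI[of 1])
  fix x y assume "x \<in> topspace (nsphere n)" "y \<in> topspace (nsphere n)"
  then show "\<bar>x i - y i\<bar> \<le> 1 * l1_dist n x y"
    using member_le_sum[of i "{..n}" "\<lambda>j. \<bar>x j - y j\<bar>"]
    by (cases "i \<le> n") (auto simp: l1_dist_def topspace_nsphere sum_nonneg)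
qed simp

lemma nsphere_lipschitz_add [lip_intros]:
  assumes "nsphere_lipschitz n f" "nsphere_lipschitz n g"
  shows "nsphere_lipschitz n (\<lambda>x. f x + g x)"
proof -
  obtain K where K: "K \<ge> 0" "\<And>x y. x \<in> topspace (nsphere n) \<Longrightarrow> y \<in> topspace (nsphere n)
      \<Longrightarrow> \<bar>f x - f y\<bar> \<le> K * l1_dist n x y"
    using assms(1) by (rule nsphere_lipschitzE) blast
  obtain L where L: "L \<ge> 0" "\<And>x y. x \<in> topspace (nsphere n) \<Longrightarrow> y \<in> topspace (nsphere n)
      \<Longrightarrow> \<bar>g x - g y\<bar> \<le> L * l1_dist n x y"
    using assms(2) by (rule nsphere_lipschitzE) blast
  show ?thesis
  proof (rule nsphere_lipschitzI[of "K + L"])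
    fix x y assume "x \<in> topspace (nsphere n)" "y \<in> topspace (nsphere n)"
    from K(2)[OF this] L(2)[OF this]
    show "\<bar>f x + g x - (f y + g y)\<bar> \<le> (K + L) * l1_dist n x y"
      by (auto simp: algebra_simps)
  qed (use K L in auto)
qed

text \<open>Lipschitz functions on the compact sphere are bounded, which controls the cross terms of
  the product.\<close>

lemma nsphere_lipschitz_mult [lip_intros]:
  assumes "nsphere_lipschitz n f" "nsphere_lipschitz n g"
  shows "nsphere_lipschitz n (\<lambda>x. f x * g x)"
proof -
  obtain K where K: "K \<ge> 0" "\<And>x y. x \<in> topspace (nsphere n) \<Longrightarrow> y \<in> topspace (nsphere n)
      \<Longrightarrow> \<bar>f x - f y\<bar> \<le> K * l1_dist n x y"
    using assms(1) by (rule nsphere_lipschitzE) blast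
  obtain L where L: "L \<ge> 0" "\<And>x y. x \<in> topspace (nsphere n) \<Longrightarrow> y \<in> topspace (nsphere n)
      \<Longrightarrow> \<bar>g x - g y\<bar> \<le> L * l1_dist n x y"
    using assms(2) by (rule nsphere_lipschitzE) blast
  obtain M where M: "M \<ge> 0" "\<And>x. x \<in> topspace (nsphere n) \<Longrightarrow> \<bar>f x\<bar> \<le> M"
    using assms(1) by (rule nsphere_lipschitz_bounded) blast
  obtain M' where M': "M' \<ge> 0" "\<And>x. x \<in> topspace (nsphere n) \<Longrightarrow> \<bar>g x\<bar> \<le> M'"
    using assms(2) by (rule nsphere_lipschitz_bounded) blast
  show ?thesis
  proof (rule nsphere_lipschitzI[of "M * L + K * M'"])
    fix x y assume xy: "x \<in> topspace (nsphere n)" "y \<in> topspace (nsphere n)"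
    have "\<bar>f x * g x - f y * g y\<bar> = \<bar>f x * (g x - g y) + (f x - f y) * g y\<bar>"
      by (simp add: algebra_simps)
    also have "\<dots> \<le> \<bar>f x\<bar> * \<bar>g x - g y\<bar> + \<bar>f x - f y\<bar> * \<bar>g y\<bar>"
      by (metis abs_mult abs_triangle_ineq)
    also have "\<dots> \<le> M * (L * l1_dist n x y) + (K * l1_dist n x y) * M'"
      using K(2)[OF xy] L(2)[OF xy] M(2)[OF xy(1)] M'(2)[OF xy(2)] K(1) M(1)
      by (intro add_mono mult_mono) auto
    finally show "\<bar>f x * g x - f y * g y\<bar> \<le> (M * L + K * M') * l1_dist n x y"
      by (simp add: algebra_simps)
  qed (use K L M M' in auto)
qed

lemma nsphere_lipschitz_compose_contraction:
  assumes "nsphere_lipschitz n f" "\<And>s t. \<bar>\<phi> s - \<phi> t\<bar> \<le> \<bar>s - t\<bar>"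
  shows "nsphere_lipschitz n (\<lambda>x. \<phi> (f x))"
  using assms unfolding nsphere_lipschitz_def by (meson order_trans)

lemma nsphere_lipschitz_max0 [lip_intros]:
  "nsphere_lipschitz n f \<Longrightarrow> nsphere_lipschitz n (\<lambda>x. max 0 (f x))"
  by (rule nsphere_lipschitz_compose_contraction[of n f "max 0"]) auto

lemma nsphere_lipschitz_abs [lip_intros]:
  "nsphere_lipschitz n f \<Longrightarrow> nsphere_lipschitz n (\<lambda>x. \<bar>f x\<bar>)"
  by (rule nsphere_lipschitz_compose_contraction) auto

lemma nsphere_lipschitz_minus [lip_intros]:
  "nsphere_lipschitz n f \<Longrightarrow> nsphere_lipschitz n (\<lambda>x. - f x)"
  by (rule nsphere_lipschitz_compose_contraction) auto

lemma nsphere_lipschitz_diff [lip_intros]: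
  "nsphere_lipschitz n f \<Longrightarrow> nsphere_lipschitz n g \<Longrightarrow> nsphere_lipschitz n (\<lambda>x. f x - g x)"
  using nsphere_lipschitz_add[OF _ nsphere_lipschitz_minus] by force

lemma nsphere_lipschitz_sum [lip_intros]:
  "(\<And>i. i \<in> I \<Longrightarrow> nsphere_lipschitz n (f i)) \<Longrightarrow> nsphere_lipschitz n (\<lambda>x. \<Sum>i\<in>I. f i x)"
  by (induction I rule: infinite_finite_induct) (auto intro!: lip_intros)

lemma nsphere_lipschitz_prod [lip_intros]:
  "(\<And>i. i \<in> I \<Longrightarrow> nsphere_lipschitz n (f i)) \<Longrightarrow> nsphere_lipschitz n (\<lambda>x. \<Prod>i\<in>I. f i x)"
  by (induction I rule: infinite_finite_induct) (auto intro!: lip_intros)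

lemma nsphere_lipschitz_reflect:
  assumes "nsphere_lipschitz n f" shows "nsphere_lipschitz n (\<lambda>x. f (- x))"
  using assms unfolding nsphere_lipschitz_def
  by (metis l1_dist_uminus uminus_in_nsphere)

lemma nsphere_lipschitz_mono:
  assumes "nsphere_lipschitz n f" "m \<le> n" shows "nsphere_lipschitz m f"
proof -
  obtain K where K: "K \<ge> 0" "\<And>x y. x \<in> topspace (nsphere n) \<Longrightarrow> y \<in> topspace (nsphere n)
      \<Longrightarrow> \<bar>f x - f y\<bar> \<le> K * l1_dist n x y"
    using assms(1) by (rule nsphere_lipschitzE) blast
  show ?thesis
  proof (rule nsphere_lipschitzI[OF K(1)])
    fix x y assume xy: "x \<in> topspace (nsphere m)" "y \<in> topspace (nsphere m)"
    have "l1_dist n x y = l1_dist m x y"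
      unfolding l1_dist_def using xy assms(2)
      by (intro sum.mono_neutral_right) (auto simp: topspace_nsphere)
    then show "\<bar>f x - f y\<bar> \<le> K * l1_dist m x y"
      using K(2)[of x y] xy nsphere_mono[OF assms(2)] by auto
  qed
qed

section \<open>The Borsuk--Ulam theorem for Lipschitz maps\<close>

lemma L2_set_nsphere_scale:
  assumes "x \<in> topspace (nsphere n)" "t \<ge> 0"
  shows "L2_set (\<lambda>j. t * x j) {..n} = t"
  using assms by (simp add: L2_set_right_distrib[symmetric]) (simp add: L2_set_def topspace_nsphere)

text \<open>The homogeneous extension of \<open>f\<close> to the cone over the sphere is again
  Lipschitz: a change of radius is paid for by the bound \<open>M\<close>, a change of direction by
  the constant \<open>K\<close>.\<close>

lemma cone_lipschitz:
  assumes K: "K \<ge> 0" "\<And>x y. x \<in> topspace (nsphere n) \<Longrightarrow> y \<in> topspace (nsphere n) \<Longrightarrow> \<bar>f x - f y\<bar> \<le> K * l1_dist n x y"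
    and M: "\<And>x. x \<in> topspace (nsphere n) \<Longrightarrow> \<bar>f x\<bar> \<le> M"
    and x: "x \<in> topspace (nsphere n)" and y: "y \<in> topspace (nsphere n)"
    and s: "s \<ge> 0" and t: "t \<ge> 0"
  shows "\<bar>s * f x - t * f y\<bar> \<le> (M + K * (real n + 2)) * (\<Sum>j\<le>n. \<bar>s * x j - t * y j\<bar>)"
proof -
  define \<delta> where "\<delta> = (\<Sum>j\<le>n. \<bar>s * x j - t * y j\<bar>)"
  have tri: "L2_set u {..n} - L2_set v {..n} \<le> (\<Sum>j\<le>n. \<bar>u j - v j\<bar>)" for u v :: "nat \<Rightarrow> real"
  proof -
    have "L2_set u {..n} \<le> L2_set (\<lambda>j. u j - v j) {..n} + L2_set v {..n}"
      using L2_set_triangle_ineq[of "\<lambda>j. u j - v j" v "{..n}"] by simp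
    then show ?thesis using L2_set_le_sum_abs[of "\<lambda>j. u j - v j" "{..n}"] by linarith
  qed
  \<comment> \<open>\<open>s\<close> and \<open>t\<close> are the Euclidean norms of the two cone
    points, so the reverse triangle inequality applies, with the l2 norm bounded by the l1
    norm.\<close>
  have st: "\<bar>s - t\<bar> \<le> \<delta>"
    using tri[of "\<lambda>j. s * x j" "\<lambda>j. t * y j"] tri[of "\<lambda>j. t * y j" "\<lambda>j. s * x j"]
    by (auto simp: L2_set_nsphere_scale[OF x s] L2_set_nsphere_scale[OF y t] \<delta>_def abs_minus_commute)
  have M0: "M \<ge> 0" using M[OF x] by linarith
  have "t * l1_dist n x y = (\<Sum>j\<le>n. \<bar>t * x j - t * y j\<bar>)"
    using t by (simp add: l1_dist_def sum_distrib_left abs_mult[symmetric] right_diff_distrib)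
       (simp add: abs_mult flip: right_diff_distrib)
  \<comment> \<open>Replacing \<open>t * x j\<close> by \<open>s * x j\<close> costs at most
    \<delta> in each of the \<open>n + 1\<close> coordinates; with \<delta> itself this gives the
    factor \<open>n + 2\<close>.\<close>
  also have "\<dots> \<le> (\<Sum>j\<le>n. \<bar>s * x j - t * y j\<bar> + \<delta>)"
  proof (rule sum_mono)
    fix j
    have "\<bar>t * x j - s * x j\<bar> \<le> \<delta> * 1"
      unfolding left_diff_distrib[symmetric] abs_mult
      using st nsphere_coord_le_1[OF x, of j] by (intro mult_mono) auto
    then show "\<bar>t * x j - t * y j\<bar> \<le> \<bar>s * x j - t * y j\<bar> + \<delta>" by linarith
  qed
  also have "\<dots> = \<delta> * (real n + 2)"
    by (simp add: sum.distrib \<delta>_def algebra_simps)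
  finally have tl: "t * l1_dist n x y \<le> \<delta> * (real n + 2)" .
  have "\<bar>s * f x - t * f y\<bar> = \<bar>(s - t) * f x + t * (f x - f y)\<bar>" by (simp add: algebra_simps)
  also have "\<dots> \<le> \<bar>s - t\<bar> * \<bar>f x\<bar> + t * \<bar>f x - f y\<bar>"
    using t by (metis abs_mult abs_of_nonneg abs_triangle_ineq)
  also have "\<dots> \<le> \<delta> * M + t * (K * l1_dist n x y)"
    using st M[OF x] K(2)[OF x y] t by (intro add_mono mult_mono mult_left_mono) auto
  also have "\<dots> \<le> \<delta> * M + K * (\<delta> * (real n + 2))"
    using mult_left_mono[OF tl K(1)] by (simp add: algebra_simps)
  finally show ?thesis unfolding \<delta>_def[symmetric] by (simp add: algebra_simps)
qed

text \<open>
  A Lipschitz map cannot raise dimension: if every line in direction \<open>(a, 1)\<close> met the image, then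
  every point of an integer grid with about \<open>N ^ (n + 2)\<close> points would lie in the
  cone over the image. Preimages in the cone over the sphere are a bounded distance apart, so
  at most \<open>O(N ^ (n + 1))\<close> of them fit.\<close>

lemma lipschitz_image_misses_line:
  fixes f :: "(nat \<Rightarrow> real) \<Rightarrow> nat \<Rightarrow> real"
  assumes lip: "\<And>i. i \<le> Suc n \<Longrightarrow> nsphere_lipschitz n (\<lambda>x. f x i)"
    and odd: "\<And>x i. x \<in> topspace (nsphere n) \<Longrightarrow> f (- x) i = - f x i"
    and nz: "\<And>x. x \<in> topspace (nsphere n) \<Longrightarrow> \<exists>i\<le>Suc n. f x i \<noteq> 0"
  shows "\<exists>a. \<forall>x\<in>topspace (nsphere n). \<exists>i\<le>n. f x i \<noteq> f x (Suc n) * a i"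
proof (rule ccontr)
  assume "\<not> ?thesis"
  then have ex: "\<exists>x\<in>topspace (nsphere n). \<forall>i\<le>n. f x i = f x (Suc n) * a i" for a by blast
  let ?S = "topspace (nsphere n)"
  have "\<forall>i\<in>{..Suc n}. \<exists>K. K \<ge> 0 \<and> (\<forall>x\<in>?S. \<forall>y\<in>?S. \<bar>f x i - f y i\<bar> \<le> K * l1_dist n x y)"
    using lip unfolding nsphere_lipschitz_def by auto
  from bchoice[OF this] obtain K where K: "\<And>i. i \<le> Suc n \<Longrightarrow> K i \<ge> 0"
      "\<And>i x y. i \<le> Suc n \<Longrightarrow> x \<in> ?S \<Longrightarrow> y \<in> ?S \<Longrightarrow> \<bar>f x i - f y i\<bar> \<le> K i * l1_dist n x y"
    by auto
  have "\<forall>i\<in>{..Suc n}. \<exists>M. M \<ge> 0 \<and> (\<forall>x\<in>?S. \<bar>f x i\<bar> \<le> M)"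
  proof
    fix i assume "i \<in> {..Suc n}"
    then have "nsphere_lipschitz n (\<lambda>x. f x i)" using lip by simp
    then obtain M where "M \<ge> 0" "\<And>x. x \<in> ?S \<Longrightarrow> \<bar>f x i\<bar> \<le> M"
      by (rule nsphere_lipschitz_bounded) blast
    then show "\<exists>M. M \<ge> 0 \<and> (\<forall>x\<in>?S. \<bar>f x i\<bar> \<le> M)" by blast
  qed
  from bchoice[OF this] obtain M where M: "\<And>i. i \<le> Suc n \<Longrightarrow> M i \<ge> 0"
      "\<And>i x. i \<le> Suc n \<Longrightarrow> x \<in> ?S \<Longrightarrow> \<bar>f x i\<bar> \<le> M i"
    by auto
  \<comment> \<open>A common Lipschitz constant of the cone map for all \<open>n + 2\<close>
    coordinates.\<close>
  define C where "C = (\<Sum>i\<le>Suc n. M i + K i * (real n + 2))"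
  have C: "M i + K i * (real n + 2) \<le> C" if "i \<le> Suc n" for i
    unfolding C_def using that K(1) M(1) by (intro member_le_sum) auto
  have C0: "C \<ge> 0" unfolding C_def using K(1) M(1) by (intro sum_nonneg) auto
  have cone: "\<bar>s * f x i - t * f y i\<bar> \<le> C * (\<Sum>j\<le>n. \<bar>s * x j - t * y j\<bar>)"
    if "i \<le> Suc n" "x \<in> ?S" "y \<in> ?S" "s \<ge> 0" "t \<ge> 0" for i x y s t
  proof -
    have "\<bar>s * f x i - t * f y i\<bar> \<le> (M i + K i * (real n + 2)) * (\<Sum>j\<le>n. \<bar>s * x j - t * y j\<bar>)"
      using that K M by (intro cone_lipschitz) auto
    also have "\<dots> \<le> C * (\<Sum>j\<le>n. \<bar>s * x j - t * y j\<bar>)"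
      using C[OF that(1)] by (intro mult_right_mono sum_nonneg) auto
    finally show ?thesis .
  qed
  have pos: "0 < (\<Sum>i\<le>Suc n. \<bar>f x i\<bar>)" if x: "x \<in> ?S" for x
  proof -
    obtain i where "i \<le> Suc n" "f x i \<noteq> 0" using nz[OF x] by blast
    then show ?thesis by (intro sum_pos2[of _ i]) auto
  qed
  have "continuous_on ?S (\<lambda>x. \<Sum>i\<le>Suc n. \<bar>f x i\<bar>)"
    using lip by (intro continuous_intros nsphere_lipschitz_imp_continuous) auto
  from nsphere_pos_lower_bound[OF this] pos obtain m where m: "m > 0" "\<forall>x\<in>?S. m \<le> (\<Sum>i\<le>Suc n. \<bar>f x i\<bar>)"
    by blast
  \<comment> \<open>The cell width: cone points in one cell are at l1 distance at most
    \<open>(n + 1) * \<eta>\<close>, so their images differ by less than 1 in every coordinate, and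
    integer images coincide.\<close>
  define \<eta> where "\<eta> = 1 / ((C + 1) * (real n + 1))"
  have "(real n + 1) * \<eta> = 1 / (C + 1)"
    using C0 of_nat_0_le_iff[of n] by (simp add: \<eta>_def divide_simps add_eq_0_iff)
  then have \<eta>: "\<eta> > 0" "C * ((real n + 1) * \<eta>) < 1"
    using C0 by (auto simp: \<eta>_def intro!: divide_pos_pos mult_pos_pos)
  \<comment> \<open>Scalars of preimages are at most \<open>R * N\<close>: images of sphere points
    have l1 norm at least \<open>m\<close>, grid points at most \<open>(n + 2) * N\<close>.\<close>
  define R where "R = (real n + 2) / m"
  have R0: "R > 0" using m(1) by (simp add: R_def)
  \<comment> \<open>Preimages meet at most \<open>c * N\<close> cells per axis. \<open>N\<close>
    exceeds \<open>c ^ Suc n\<close>, so that \<open>N ^ (n + 2)\<close> beats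
    \<open>(c * N) ^ (n + 1)\<close>.\<close>
  define c where "c = 2 * nat \<lceil>R / \<eta>\<rceil> + 4"
  define N where "N = c ^ Suc n + 1"
  \<comment> \<open>The last grid coordinate starts at 1 because it serves as the denominator of the
    direction passed to \<open>ex\<close>.\<close>
  define G where "G = PiE {..n} (\<lambda>_. {0..int N}) \<times> {1..int N}"
  define g where "g = (\<lambda>(p :: (nat \<Rightarrow> int) \<times> int) i. real_of_int (if i \<le> n then fst p i else snd p))"
  have point: "\<exists>t x. t \<ge> 0 \<and> x \<in> ?S \<and> (\<forall>i\<le>Suc n. t * f x i = g p i)" if p: "p \<in> G" for p
  proof -
    have sp: "real_of_int (snd p) > 0" using p by (auto simp: G_def)
    obtain x where x: "x \<in> ?S" "\<forall>i\<le>n. f x i = f x (Suc n) * (g p i / g p (Suc n))"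
      using ex[of "\<lambda>i. g p i / g p (Suc n)"] by blast
    have c0: "f x (Suc n) \<noteq> 0" using nz[OF x(1)] x(2) by (metis le_Suc_eq mult_zero_left)
    define t where "t = g p (Suc n) / f x (Suc n)"
    have gs: "g p (Suc n) \<noteq> 0" using sp by (simp add: g_def)
    have t: "t * f x i = g p i" if "i \<le> Suc n" for i
    proof (cases "i = Suc n")
      case False
      with that have "i \<le> n" by simp
      then show ?thesis using x(2)[rule_format, of i] c0 gs by (simp add: t_def)
    qed (use c0 in \<open>simp add: t_def\<close>)
    \<comment> \<open>A negative scalar is made nonnegative by passing to \<open>- x\<close>, using
      oddness.\<close>
    show ?thesis
    proof (cases "t \<ge> 0")
      case True then show ?thesis using x(1) t by blast
    next
      case False
      have "- t \<ge> 0 \<and> - x \<in> ?S \<and> (\<forall>i\<le>Suc n. - t * f (- x) i = g p i)"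
        using False x(1) t odd[OF x(1)] by auto
      then show ?thesis by blast
    qed
  qed
  then have "\<forall>p\<in>G. \<exists>tx. fst tx \<ge> 0 \<and> snd tx \<in> ?S \<and> (\<forall>i\<le>Suc n. fst tx * f (snd tx) i = g p i)"
    by simp
  from bchoice[OF this] obtain tx where tx': "\<forall>p\<in>G. fst (tx p) \<ge> 0 \<and> snd (tx p) \<in> ?S \<and>
      (\<forall>i\<le>Suc n. fst (tx p) * f (snd (tx p)) i = g p i)" ..
  define t where "t = fst \<circ> tx"
  define x where "x = snd \<circ> tx"
  have tx: "\<And>p. p \<in> G \<Longrightarrow> t p \<ge> 0" "\<And>p. p \<in> G \<Longrightarrow> x p \<in> ?S"
      "\<And>p i. p \<in> G \<Longrightarrow> i \<le> Suc n \<Longrightarrow> t p * f (x p) i = g p i"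
    using tx' by (auto simp: t_def x_def)
  have tR: "t p \<le> R * real N" if p: "p \<in> G" for p
  proof -
    have "t p * m \<le> t p * (\<Sum>i\<le>Suc n. \<bar>f (x p) i\<bar>)"
      using tx(1,2)[OF p] m(2) by (intro mult_left_mono) auto
    also have "\<dots> = (\<Sum>i\<le>Suc n. \<bar>g p i\<bar>)"
      unfolding sum_distrib_left
      by (rule sum.cong) (use tx(1)[OF p] in \<open>auto simp: abs_mult tx(3)[OF p, symmetric]\<close>)
    also have "\<dots> \<le> (\<Sum>i\<le>Suc n. real N)"
    proof (rule sum_mono)
      fix i
      have "(if i \<le> n then fst p i else snd p) \<in> {0..int N}"
        using p by (auto simp: G_def PiE_iff)
      then show "\<bar>g p i\<bar> \<le> real N" unfolding g_def by (simp del: if_split)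
    qed
    finally show ?thesis using m(1) by (simp add: R_def field_simps)
  qed
  define cell where "cell = (\<lambda>p. \<lambda>j\<in>{..n}. \<lfloor>t p * x p j / \<eta>\<rfloor>)"
  have "inj_on cell G"
  proof (rule inj_onI)
    fix p q assume p: "p \<in> G" and q: "q \<in> G" and eq: "cell p = cell q"
    have near: "\<bar>t p * x p j - t q * x q j\<bar> \<le> \<eta>" if "j \<le> n" for j
    proof -
      have "\<lfloor>t p * x p j / \<eta>\<rfloor> = \<lfloor>t q * x q j / \<eta>\<rfloor>"
        using fun_cong[OF eq, of j] that by (simp add: cell_def)
      then have "\<bar>t p * x p j / \<eta> - t q * x q j / \<eta>\<bar> < 1" by linarith
      then show ?thesis using \<eta>(1) by (simp add: field_simps flip: diff_divide_distrib)
    qed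
    have "(\<Sum>j\<le>n. \<bar>t p * x p j - t q * x q j\<bar>) \<le> (\<Sum>j\<le>n. \<eta>)"
      using near by (intro sum_mono) auto
    then have sum: "(\<Sum>j\<le>n. \<bar>t p * x p j - t q * x q j\<bar>) \<le> (real n + 1) * \<eta>"
      by (simp add: algebra_simps)
    have geq: "g p i = g q i" if i: "i \<le> Suc n" for i
    proof -
      have "\<bar>g p i - g q i\<bar> \<le> C * (\<Sum>j\<le>n. \<bar>t p * x p j - t q * x q j\<bar>)"
        using cone[OF i tx(2)[OF p] tx(2)[OF q] tx(1)[OF p] tx(1)[OF q]] tx(3)[OF p i] tx(3)[OF q i]
        by simp
      also have "\<dots> < 1" using mult_left_mono[OF sum C0] \<eta>(2) by linarith
      finally show ?thesis by (auto simp: g_def split: if_splits)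
    qed
    have "fst p i = fst q i" for i
      using geq[of i] p q by (cases "i \<le> n") (auto simp: g_def G_def PiE_iff extensional_def)
    moreover have "snd p = snd q" using geq[of "Suc n"] by (simp add: g_def)
    ultimately show "p = q" by (simp add: prod_eq_iff fun_eq_iff)
  qed
  \<comment> \<open>\<open>c div 2 - 1\<close> equals
    \<open>nat \<lceil>R / \<eta>\<rceil> + 1\<close>, where the extra 1 pays for rounding
    down.\<close>
  moreover have "cell ` G \<subseteq> PiE {..n} (\<lambda>_. {- int (N * (c div 2 - 1)) .. int (N * (c div 2 - 1))})"
  proof -
    have "\<bar>\<lfloor>t p * x p j / \<eta>\<rfloor>\<bar> \<le> int (N * (c div 2 - 1))" if p: "p \<in> G" for p j
    proof -
      have "\<bar>t p * x p j\<bar> \<le> (R * real N) * 1"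
        unfolding abs_mult using tx[OF p] tR[OF p] nsphere_coord_le_1[of "x p" n j]
        by (intro mult_mono) auto
      then have "\<bar>t p * x p j / \<eta>\<bar> \<le> (R / \<eta>) * real N"
        using \<eta>(1) by (simp add: field_simps)
      also have "\<dots> \<le> real (nat \<lceil>R / \<eta>\<rceil>) * real N"
        by (intro mult_right_mono) linarith+
      finally have "\<bar>t p * x p j / \<eta>\<bar> \<le> real (nat \<lceil>R / \<eta>\<rceil> * N)" by simp
      then have "\<bar>\<lfloor>t p * x p j / \<eta>\<rfloor>\<bar> \<le> int (nat \<lceil>R / \<eta>\<rceil> * N) + 1" by linarith
      also have "\<dots> \<le> int (nat \<lceil>R / \<eta>\<rceil> * N) + int N" by (simp add: N_def)
      also have "\<dots> = int (N * (c div 2 - 1))" by (simp add: c_def algebra_simps)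
      finally show ?thesis .
    qed
    then have "\<lfloor>t p * x p j / \<eta>\<rfloor> \<in> {- int (N * (c div 2 - 1)) .. int (N * (c div 2 - 1))}" if "p \<in> G" for p j
      using that by (metis abs_le_iff atLeastAtMost_iff minus_le_iff)
    then show ?thesis by (intro image_subsetI PiE_I) (simp_all only: cell_def restrict_apply if_True if_False refl)
  qed
  ultimately have "card G \<le> card (PiE {..n} (\<lambda>_. {- int (N * (c div 2 - 1)) .. int (N * (c div 2 - 1))}))"
    by (intro card_inj_on_le finite_PiE) auto
  also have "\<dots> = (2 * (N * (c div 2 - 1)) + 1) ^ Suc n"
    by (simp add: card_PiE nat_add_distrib nat_mult_distrib)
  also have "\<dots> \<le> (c * N) ^ Suc n"
  proof (rule power_mono)
    have "2 * (N * (c div 2 - 1)) + 1 = N * (2 * nat \<lceil>R / \<eta>\<rceil> + 2) + 1"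
      by (simp add: c_def algebra_simps)
    also have "\<dots> \<le> N * (2 * nat \<lceil>R / \<eta>\<rceil> + 2) + N" by (simp add: N_def)
    also have "\<dots> \<le> c * N" by (simp add: c_def algebra_simps)
    finally show "2 * (N * (c div 2 - 1)) + 1 \<le> c * N" .
  qed simp
  also have "\<dots> < N * N ^ Suc n"
    unfolding power_mult_distrib by (intro mult_strict_right_mono) (auto simp: N_def)
  also have "\<dots> \<le> N * Suc N ^ Suc n" by (intro mult_left_mono power_mono) auto
  also have "\<dots> = card G" by (simp add: G_def card_cartesian_product card_PiE nat_add_distrib)
  finally show False by simp
qed

section \<open>Radial projection and the degree of odd maps\<close>

definition normalize_vec :: "nat \<Rightarrow> (nat \<Rightarrow> real) \<Rightarrow> nat \<Rightarrow> real" where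
  "normalize_vec n v = (\<lambda>i. if i \<le> n then v i / sqrt (\<Sum>j\<le>n. (v j)\<^sup>2) else 0)"

lemma sum_squares_pos: "\<exists>i\<le>n. v i \<noteq> 0 \<Longrightarrow> 0 < (\<Sum>j\<le>(n :: nat). (v j :: real)\<^sup>2)"
proof -
  assume "\<exists>i\<le>n. v i \<noteq> 0"
  then obtain i where "i \<le> n" "v i \<noteq> 0" by blast
  then show ?thesis by (intro sum_pos2[of _ i]) auto
qed

lemma normalize_vec_in_nsphere:
  assumes "\<exists>i\<le>n. v i \<noteq> 0" shows "normalize_vec n v \<in> topspace (nsphere n)"
proof -
  have "(\<Sum>i\<le>n. (normalize_vec n v i)\<^sup>2) = (\<Sum>i\<le>n. (v i)\<^sup>2) / (\<Sum>j\<le>n. (v j)\<^sup>2)"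
    using sum_squares_pos[OF assms]
    by (simp add: normalize_vec_def power_divide flip: sum_divide_distrib)
  then show ?thesis
    using sum_squares_pos[OF assms] by (simp add: topspace_nsphere) (simp add: normalize_vec_def)
qed

lemma normalize_vec_uminus: "normalize_vec n (- v) = - normalize_vec n v"
  by (auto simp: normalize_vec_def)

lemma normalize_vec_Suc:
  "v (Suc n) = 0 \<Longrightarrow> normalize_vec (Suc n) v = normalize_vec n v"
  by (auto simp: normalize_vec_def le_Suc_eq)

lemma continuous_map_normalize_vec:
  assumes "\<And>i. i \<le> n \<Longrightarrow> continuous_map X euclideanreal (\<lambda>x. f x i)"
    and "\<And>x. x \<in> topspace X \<Longrightarrow> \<exists>i\<le>n. f x i \<noteq> 0"
  shows "continuous_map X (nsphere n) (\<lambda>x. normalize_vec n (f x))"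
proof -
  have "continuous_map X euclideanreal (\<lambda>x. f x i / sqrt (\<Sum>j\<le>n. (f x j)\<^sup>2))" if "i \<le> n" for i
    using assms(1) that sum_squares_pos[OF assms(2)]
    by (intro continuous_intros) force+
  then have "continuous_map X euclideanreal (\<lambda>x. normalize_vec n (f x) i)" for i
    by (cases "i \<le> n") (simp_all add: normalize_vec_def)
  moreover have "normalize_vec n (f x) \<in> topspace (nsphere n)" if "x \<in> topspace X" for x
    using normalize_vec_in_nsphere assms(2) that by blast
  ultimately show ?thesis
    unfolding nsphere continuous_map_in_subtopology continuous_map_componentwise_UNIV
    by (auto simp: topspace_nsphere)
qed

text \<open>The 0-sphere is a pair of antipodes, so an odd self-map is the identity or the
  reflection, of degree 1 or -1.\<close>

lemma Brouwer_degree2_nsphere_0: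
  assumes "f \<in> topspace (nsphere 0) \<rightarrow> topspace (nsphere 0)"
    and "\<And>x. x \<in> topspace (nsphere 0) \<Longrightarrow> f (- x) = - f x"
  shows "odd (Brouwer_degree2 0 f)"
proof -
  define e where "e = (\<lambda>i :: nat. if i = 0 then 1 else 0 :: real)"
  have S: "topspace (nsphere 0) = {e, - e}"
  proof -
    have "x = e \<or> x = - e" if "(x 0)\<^sup>2 = 1" "\<forall>i>0. x i = 0" for x
    proof -
      have "x 0 = 1 \<or> x 0 = - 1" using that(1) by (simp add: power2_eq_1_iff)
      then show ?thesis using that(2) by (auto simp: e_def fun_eq_iff)
    qed
    then show ?thesis by (auto simp: topspace_nsphere e_def)
  qed
  then consider "f e = e" | "f e = - e" using assms(1) by auto
  then show ?thesis
  proof cases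
    case 1
    then have "Brouwer_degree2 0 f = Brouwer_degree2 0 id"
      using assms(2) S by (intro Brouwer_degree2_eq) auto
    then show ?thesis by simp
  next
    case 2
    then have "f x = - x" if "x \<in> topspace (nsphere 0)" for x
      using assms(2)[of e] S that by auto
    moreover have "(\<lambda>i. if i = 0 then - x i else x i) = - x" if "x \<in> topspace (nsphere 0)" for x
      using that by (auto simp: topspace_nsphere)
    ultimately have "Brouwer_degree2 0 f = Brouwer_degree2 0 (\<lambda>x i. if i = 0 then -x i else x i)"
      by (intro Brouwer_degree2_eq) auto
    then show ?thesis using Brouwer_degree2_reflection[of 0] by simp
  qed
qed

text \<open>
  The homotopy \<open>H\<close> first shears the line missed by the image of the equator onto the last
  axis and at the same time flattens the last coordinate over the equator, so that its end
  map preserves the equator and \<open>Borsuk_odd_mapping_degree_step\<close> applies.\<close>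

lemma odd_Brouwer_degree2:
  assumes "\<And>i. i \<le> p \<Longrightarrow> nsphere_lipschitz p (\<lambda>x. f x i)"
    and "\<And>x i. x \<in> topspace (nsphere p) \<Longrightarrow> f (- x) i = - f x i"
    and "\<And>x. x \<in> topspace (nsphere p) \<Longrightarrow> \<exists>i\<le>p. f x i \<noteq> 0"
  shows "odd (Brouwer_degree2 p (\<lambda>x. normalize_vec p (f x)))"
  using assms
proof (induction p arbitrary: f)
  case 0
  show ?case
  proof (rule Brouwer_degree2_nsphere_0)
    fix x assume "x \<in> topspace (nsphere 0)"
    then have "f (- x) = - f x" by (intro ext) (simp add: 0(2))
    then show "normalize_vec 0 (f (- x)) = - normalize_vec 0 (f x)"
      by (simp add: normalize_vec_uminus)
  qed (use normalize_vec_in_nsphere 0(3) in blast)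
next
  case (Suc q)
  let ?p = "Suc q"
  have sub: "topspace (nsphere q) \<subseteq> topspace (nsphere ?p)" by (rule nsphere_mono) simp
  have "\<exists>a. \<forall>x\<in>topspace (nsphere q). \<exists>i\<le>q. f x i \<noteq> f x ?p * a i"
  proof (rule lipschitz_image_misses_line)
    fix i assume "i \<le> ?p"
    from Suc.prems(1)[OF this] show "nsphere_lipschitz q (\<lambda>x. f x i)"
      by (rule nsphere_lipschitz_mono) simp
  next
    fix x i assume "x \<in> topspace (nsphere q)"
    then show "f (- x) i = - f x i" using Suc.prems(2)[of x] sub by blast
  next
    fix x assume "x \<in> topspace (nsphere q)"
    then show "\<exists>i\<le>?p. f x i \<noteq> 0" using Suc.prems(3)[of x] sub by blast
  qed
  then obtain a where a: "\<And>x. x \<in> topspace (nsphere q) \<Longrightarrow> \<exists>i\<le>q. f x i \<noteq> f x ?p * a i"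
    by blast
  \<comment> \<open>At \<open>s = 1\<close> the last coordinate carries the factor
    \<open>(x ?p)\<^sup>2\<close>, which vanishes on the equator; the shear by \<open>a\<close>
    keeps the other coordinates from vanishing together there.\<close>
  define H where "H = (\<lambda>(s :: real, x) i. if i = ?p then (1 - s * (1 - (x ?p)\<^sup>2)) * f x ?p
                                   else f x i - s * (f x ?p * a i))"
  define h where "h = (\<lambda>x. H (1, x))"
  have H0: "H (0, x) = f x" for x by (auto simp: H_def fun_eq_iff)
  \<comment> \<open>At a zero of \<open>H (s, x)\<close> the value \<open>f x ?p\<close> is nonzero,
    as otherwise \<open>f x\<close> would vanish altogether. The last coordinate then forces
    \<open>s = 1\<close> and \<open>x\<close> on the equator, against the choice of
    \<open>a\<close>.\<close>
  have nz: "\<exists>i\<le>?p. H (s, x) i \<noteq> 0" if s: "0 \<le> s" "s \<le> 1" and x: "x \<in> topspace (nsphere ?p)" for s x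
  proof (rule ccontr)
    assume "\<not> ?thesis"
    then have z: "H (s, x) i = 0" if "i \<le> ?p" for i using that by blast
    have fp: "f x ?p \<noteq> 0"
    proof
      assume 0: "f x ?p = 0"
      have "f x i = 0" if "i \<le> ?p" for i
        using z[OF that] 0 by (cases "i = ?p") (auto simp: H_def)
      then show False using Suc.prems(3)[OF x] by blast
    qed
    have s1: "s * (1 - (x ?p)\<^sup>2) = 1" using z[of ?p] fp by (simp add: H_def)
    have le: "(x ?p)\<^sup>2 \<le> 1" using nsphere_coord_le_1[OF x, of ?p] by (simp add: abs_square_le_1)
    have "s * (1 - (x ?p)\<^sup>2) \<le> 1 * (1 - (x ?p)\<^sup>2)" using le s by (intro mult_right_mono) auto
    then have "(x ?p)\<^sup>2 \<le> 0" using s1 by simp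
    then have xp: "x ?p = 0" by simp
    with s1 have "s = 1" by simp
    have "x \<in> topspace (nsphere q)" using topspace_nsphere_minus1[OF x xp] by simp
    from a[OF this] obtain i where i: "i \<le> q" "f x i \<noteq> f x ?p * a i" by blast
    then show False using z[of i] \<open>s = 1\<close> by (simp add: H_def)
  qed
  have "homotopic_with (\<lambda>x. True) (nsphere ?p) (nsphere ?p)
          (\<lambda>x. normalize_vec ?p (f x)) (\<lambda>x. normalize_vec ?p (h x))"
  proof -
    let ?X = "prod_topology (top_of_set {0..1::real}) (nsphere ?p)"
    have fst: "continuous_map ?X euclideanreal fst"
      by (rule continuous_map_into_fulltopology[OF continuous_map_fst])
    have coord: "continuous_map ?X euclideanreal (\<lambda>z. snd z i)" for i
      using continuous_map_compose[OF continuous_map_snd continuous_map_nsphere_projection]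
      by (simp add: comp_def)
    have comp: "continuous_map ?X euclideanreal (\<lambda>z. f (snd z) i)" if "i \<le> ?p" for i
    proof -
      have "continuous_map (nsphere ?p) euclideanreal (\<lambda>x. f x i)"
        using Suc.prems(1)[OF that] nsphere_lipschitz_imp_continuous continuous_map_nsphere_real by blast
      from continuous_map_compose[OF continuous_map_snd this] show ?thesis by (simp add: comp_def)
    qed
    have "continuous_map ?X (nsphere ?p) (\<lambda>z. normalize_vec ?p (H z))"
    proof (rule continuous_map_normalize_vec)
      fix i assume i: "i \<le> ?p"
      show "continuous_map ?X euclideanreal (\<lambda>z. H z i)"
        using comp[OF i] comp[of ?p] coord[of ?p] fst
        by (cases "i = ?p") (auto simp: H_def case_prod_unfold intro!: continuous_intros)
    next
      fix z assume "z \<in> topspace ?X"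
      then show "\<exists>i\<le>?p. H z i \<noteq> 0" using nz[of "fst z" "snd z"] by auto
    qed
    then show ?thesis
      unfolding homotopic_with_def by (intro exI[of _ "\<lambda>z. normalize_vec ?p (H z)"]) (auto simp: H0 h_def)
  qed
  then have deg: "Brouwer_degree2 ?p (\<lambda>x. normalize_vec ?p (f x)) = Brouwer_degree2 ?p (\<lambda>x. normalize_vec ?p (h x))"
    by (rule Brouwer_degree2_homotopic)
  have hodd: "h (- x) = - h x" if "x \<in> topspace (nsphere ?p)" for x
    by (intro ext) (simp add: h_def H_def Suc.prems(2)[OF that] algebra_simps)
  have hnz: "\<exists>i\<le>?p. h x i \<noteq> 0" if "x \<in> topspace (nsphere ?p)" for x
    using nz[of 1 x] that by (simp add: h_def)
  have hlip: "nsphere_lipschitz ?p (\<lambda>x. h x i)" if "i \<le> ?p" for i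
    using Suc.prems(1)[OF that] Suc.prems(1)[of ?p]
    by (cases "i = ?p") (auto simp: h_def H_def power2_eq_square intro!: lip_intros)
  have hq: "h x ?p = 0" if "x \<in> topspace (nsphere q)" for x
    using that by (simp add: h_def H_def topspace_nsphere)
  have hnzq: "\<exists>i\<le>q. h x i \<noteq> 0" if x: "x \<in> topspace (nsphere q)" for x
  proof -
    have "x \<in> topspace (nsphere ?p)" using x sub by blast
    from hnz[OF this] obtain i where "i \<le> ?p" "h x i \<noteq> 0" by blast
    then have "i \<le> q" using hq[OF x] by (cases "i = ?p") auto
    then show ?thesis using \<open>h x i \<noteq> 0\<close> by blast
  qed
  have "odd (Brouwer_degree2 q (\<lambda>x. normalize_vec q (h x)))"
  proof (rule Suc.IH)
    fix i assume "i \<le> q"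
    then show "nsphere_lipschitz q (\<lambda>x. h x i)"
      by (intro nsphere_lipschitz_mono[OF hlip]) auto
  next
    fix x i assume "x \<in> topspace (nsphere q)"
    then have "x \<in> topspace (nsphere ?p)" using sub by blast
    from hodd[OF this] show "h (- x) i = - h x i" by simp
  qed (rule hnzq)
  moreover have "Brouwer_degree2 q (\<lambda>x. normalize_vec q (h x)) = Brouwer_degree2 q (\<lambda>x. normalize_vec ?p (h x))"
    by (rule Brouwer_degree2_eq) (rule normalize_vec_Suc[symmetric], rule hq)
  moreover have "even (Brouwer_degree2 ?p (\<lambda>x. normalize_vec ?p (h x)) - Brouwer_degree2 (?p - Suc 0) (\<lambda>x. normalize_vec ?p (h x)))"
  proof (rule Borsuk_odd_mapping_degree_step)
    show "continuous_map (nsphere ?p) (nsphere ?p) (\<lambda>x. normalize_vec ?p (h x))"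
      using hlip nsphere_lipschitz_imp_continuous hnz
      by (intro continuous_map_normalize_vec) (auto simp: continuous_map_nsphere_real)
  next
    fix u assume u: "u \<in> topspace (nsphere ?p)"
    have "normalize_vec ?p (h (- u)) = - normalize_vec ?p (h u)"
      by (simp add: hodd[OF u] normalize_vec_uminus)
    then show "((\<lambda>x. normalize_vec ?p (h x)) \<circ> (\<lambda>x i. - x i)) u = ((\<lambda>x i. - x i) \<circ> (\<lambda>x. normalize_vec ?p (h x))) u"
      by (simp add: fun_Compl_def)
  next
    have "normalize_vec ?p (h x) \<in> topspace (nsphere q)" if "x \<in> topspace (nsphere q)" for x
      using normalize_vec_in_nsphere[OF hnzq[OF that]] normalize_vec_Suc[of "h x", OF hq[OF that]]
      by simp
    then show "(\<lambda>x. normalize_vec ?p (h x)) \<in> topspace (nsphere (?p - Suc 0)) \<rightarrow> topspace (nsphere (?p - Suc 0))"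
      by simp
  qed
  ultimately show ?case using deg by simp
qed

text \<open>Padded by zeros, the functions form a map whose coordinate \<open>n\<close> vanishes, as
  \<open>m \<le> n\<close>. Without a common zero its normalization would have odd degree, but it
  omits the pole \<open>e\<close> and so has degree 0.\<close>

theorem Borsuk_Ulam_lipschitz:
  assumes "m \<le> n"
    and lip: "\<And>i. i < m \<Longrightarrow> nsphere_lipschitz n (\<lambda>x. f x i)"
    and odd: "\<And>x i. x \<in> topspace (nsphere n) \<Longrightarrow> i < m \<Longrightarrow> f (- x) i = - f x i"
  shows "\<exists>x\<in>topspace (nsphere n). \<forall>i<m. f x i = (0 :: real)"
proof (rule ccontr)
  assume contr: "\<not> ?thesis"
  define F where "F = (\<lambda>x i. if i < m then f x i else 0)"
  have lipF: "nsphere_lipschitz n (\<lambda>x. F x i)" for i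
    using lip by (cases "i < m") (auto simp: F_def intro: lip_intros)
  have nz: "\<exists>i\<le>n. F x i \<noteq> 0" if x: "x \<in> topspace (nsphere n)" for x
  proof -
    obtain i where "i < m" "f x i \<noteq> 0" using contr x by blast
    then show ?thesis using \<open>m \<le> n\<close> by (intro exI[of _ i]) (auto simp: F_def)
  qed
  have "odd (Brouwer_degree2 n (\<lambda>x. normalize_vec n (F x)))"
    using lipF nz odd by (intro odd_Brouwer_degree2) (auto simp: F_def)
  moreover have "Brouwer_degree2 n (\<lambda>x. normalize_vec n (F x)) = 0"
  proof (rule Brouwer_degree2_nonsurjective)
    show "continuous_map (nsphere n) (nsphere n) (\<lambda>x. normalize_vec n (F x))"
      using lipF nsphere_lipschitz_imp_continuous nz
      by (intro continuous_map_normalize_vec) (auto simp: continuous_map_nsphere_real)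
    define e where "e = (\<lambda>i. if i = n then 1 else 0 :: real)"
    have "e \<in> topspace (nsphere n)"
      by (simp add: topspace_nsphere e_def if_distrib[of "\<lambda>x. x\<^sup>2"] cong: if_cong)
    moreover have "e \<noteq> normalize_vec n (F x)" for x
    proof -
      have "normalize_vec n (F x) n = 0" using \<open>m \<le> n\<close> by (simp add: normalize_vec_def F_def)
      moreover have "e n = 1" by (simp add: e_def)
      ultimately show ?thesis by auto
    qed
    ultimately show "(\<lambda>x. normalize_vec n (F x)) ` topspace (nsphere n) \<noteq> topspace (nsphere n)"
      by blast
  qed
  ultimately show False by simp
qed

section \<open>Alternating chains\<close>

text \<open>The index \<open>k\<close> counts steps, so the chain has \<open>k + 1\<close> elements.\<close>

fun alt_chain :: "'a rel \<Rightarrow> 'a set \<Rightarrow> 'a set \<Rightarrow> nat \<Rightarrow> 'a \<Rightarrow> bool" where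
  "alt_chain Q A B 0 x \<longleftrightarrow> x \<in> A"
| "alt_chain Q A B (Suc k) x \<longleftrightarrow> x \<in> A \<and> (\<exists>y. (x, y) \<in> Q \<and> alt_chain Q B A k y)"

lemma alt_chain_start: "alt_chain Q A B k x \<Longrightarrow> x \<in> A"
  by (cases k) auto

lemma alt_chain_mono:
  "alt_chain Q A B k x \<Longrightarrow> A \<subseteq> A' \<Longrightarrow> B \<subseteq> B' \<Longrightarrow> alt_chain Q A' B' k x"
proof (induction k arbitrary: x A B A' B')
  case (Suc k)
  from Suc.prems obtain y where y: "x \<in> A'" "(x, y) \<in> Q" "alt_chain Q B A k y" by auto
  from Suc.IH[OF y(3) Suc.prems(3,2)] y show ?case by auto
qed auto

definition alt_bounded :: "nat \<Rightarrow> 'a rel \<Rightarrow> 'a set \<Rightarrow> 'a set \<Rightarrow> bool" where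
  "alt_bounded K Q A B \<longleftrightarrow> (\<forall>k x. alt_chain Q A B k x \<or> alt_chain Q B A k x \<longrightarrow> k < K)"

lemma alt_bounded_mono:
  "alt_bounded K Q A' B' \<Longrightarrow> A \<subseteq> A' \<Longrightarrow> B \<subseteq> B' \<Longrightarrow> alt_bounded K Q A B"
  unfolding alt_bounded_def by (meson alt_chain_mono)

lemma alt_bounded_swap: "alt_bounded K Q A B \<longleftrightarrow> alt_bounded K Q B A"
  unfolding alt_bounded_def by blast

section \<open>Longest alternating chains and their starting points\<close>

text \<open>Chains starting in \<open>A\<close> and chains starting in \<open>B\<close> compete for
  one maximum, which makes it symmetric in the two sides.\<close>

definition max_alt :: "'a rel \<Rightarrow> 'a set \<Rightarrow> 'a set \<Rightarrow> nat" where
  "max_alt Q A B = (GREATEST k. \<exists>x. alt_chain Q A B k x \<or> alt_chain Q B A k x)"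

lemma max_alt_swap: "max_alt Q A B = max_alt Q B A"
  unfolding max_alt_def by (rule arg_cong[of _ _ Greatest]) blast

lemma max_alt:
  assumes "alt_bounded K Q A B" "A \<union> B \<noteq> {}"
  shows max_alt_attained: "\<exists>x. alt_chain Q A B (max_alt Q A B) x \<or> alt_chain Q B A (max_alt Q A B) x"
    and max_alt_less: "max_alt Q A B < K"
    and max_alt_ge: "alt_chain Q A B k x \<or> alt_chain Q B A k x \<Longrightarrow> k \<le> max_alt Q A B"
proof -
  let ?P = "\<lambda>k. \<exists>x. alt_chain Q A B k x \<or> alt_chain Q B A k x"
  have bd: "\<And>k. ?P k \<Longrightarrow> k \<le> K" using assms(1) unfolding alt_bounded_def by (meson less_imp_le)
  have "?P 0" using assms(2) by auto
  from GreatestI_nat[of ?P, OF this bd] show 1: "?P (max_alt Q A B)" unfolding max_alt_def by blast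
  then show "max_alt Q A B < K" using assms(1) unfolding alt_bounded_def by blast
  show "alt_chain Q A B k x \<or> alt_chain Q B A k x \<Longrightarrow> k \<le> max_alt Q A B"
    unfolding max_alt_def by (rule Greatest_le_nat[of ?P, OF _ bd]) auto
qed

definition max_starts :: "'a rel \<Rightarrow> 'a set \<Rightarrow> 'a set \<Rightarrow> 'a set" where
  "max_starts Q A B = {x. alt_chain Q A B (max_alt Q A B) x}"

lemma max_starts_subset: "max_starts Q A B \<subseteq> A"
  using alt_chain_start by (fastforce simp: max_starts_def)

lemma max_starts_nonempty:
  "alt_bounded K Q A B \<Longrightarrow> A \<union> B \<noteq> {} \<Longrightarrow> max_starts Q A B \<union> max_starts Q B A \<noteq> {}"
  using max_alt_attained[of K Q A B] by (auto simp: max_starts_def max_alt_swap[of Q B A])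

lemma max_starts_incomparable:
  assumes "alt_bounded K Q A B" "x \<in> max_starts Q A B" "y \<in> max_starts Q B A"
  shows "(x, y) \<notin> Q"
proof
  assume "(x, y) \<in> Q"
  then have "alt_chain Q A B (Suc (max_alt Q A B)) x"
    using assms(2,3) alt_chain_start by (auto simp: max_starts_def max_alt_swap[of Q B A])
  moreover have "A \<union> B \<noteq> {}" using assms(2) max_starts_subset by fast
  ultimately show False using max_alt_ge[OF assms(1)] by fastforce
qed

text \<open>Chains survive enlarging both sides, and under equal maxima a longest one remains
  longest.\<close>

lemma max_starts_mono:
  assumes "A \<subseteq> A'" "B \<subseteq> B'" "max_alt Q A B = max_alt Q A' B'"
  shows "max_starts Q A B \<subseteq> max_starts Q A' B'"
  using assms alt_chain_mono by (fastforce simp: max_starts_def)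

text \<open>
  Restricting to starting points of longest alternating \<open>Q\<close>-chains makes the two sides
  \<open>Q\<close>-incomparable, since such a chain could otherwise be prolonged. After
  all relations have been used one side is empty, and the other one carries the sign.\<close>

fun final_starts :: "'a rel list \<Rightarrow> 'a set \<Rightarrow> 'a set \<Rightarrow> 'a set" where
  "final_starts [] A B = A"
| "final_starts (Q # Qs) A B = final_starts Qs (max_starts Q A B) (max_starts Q B A)"

text \<open>The successive maxima are the digits of a base \<open>K\<close> number, the first
  relation giving the leading digit. The tuple is coded injectively once all maxima are below
  \<open>K\<close>.\<close>

fun alt_level :: "nat \<Rightarrow> 'a rel list \<Rightarrow> 'a set \<Rightarrow> 'a set \<Rightarrow> nat" where
  "alt_level K [] A B = 0"
| "alt_level K (Q # Qs) A B =
     max_alt Q A B * K ^ length Qs + alt_level K Qs (max_starts Q A B) (max_starts Q B A)"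

lemma alt_level_swap: "alt_level K Qs A B = alt_level K Qs B A"
  by (induction Qs arbitrary: A B) (auto simp: max_alt_swap)

lemma final_starts_subset: "final_starts Qs A B \<subseteq> A"
  by (induction Qs arbitrary: A B) (auto dest: max_starts_subset[THEN subsetD])

lemma alt_bounded_max_starts:
  "alt_bounded K Q A B \<Longrightarrow> alt_bounded K Q (max_starts Q' A B) (max_starts Q' B A)"
  by (erule alt_bounded_mono) (rule max_starts_subset)+

lemma alt_level_less:
  "\<forall>Q\<in>set Qs. alt_bounded K Q A B \<Longrightarrow> A \<union> B \<noteq> {} \<Longrightarrow> alt_level K Qs A B < K ^ length Qs"
proof (induction Qs arbitrary: A B)
  case (Cons Q Qs)
  have "max_alt Q A B < K" using max_alt_less[of K Q A B] Cons.prems by simp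
  then have "Suc (max_alt Q A B) * K ^ length Qs \<le> K * K ^ length Qs"
    by (intro mult_right_mono) auto
  moreover have "alt_level K Qs (max_starts Q A B) (max_starts Q B A) < K ^ length Qs"
    using Cons.prems max_starts_nonempty[of K Q A B] by (intro Cons.IH) (auto intro: alt_bounded_max_starts)
  ultimately show ?case by simp
qed simp

lemma final_starts_nonempty:
  "\<forall>Q\<in>set Qs. alt_bounded K Q A B \<Longrightarrow> A \<union> B \<noteq> {} \<Longrightarrow>
   final_starts Qs A B \<union> final_starts Qs B A \<noteq> {}"
proof (induction Qs arbitrary: A B)
  case (Cons Q Qs)
  have "final_starts Qs (max_starts Q A B) (max_starts Q B A) \<union>
      final_starts Qs (max_starts Q B A) (max_starts Q A B) \<noteq> {}"
    using Cons.prems max_starts_nonempty[of K Q A B] by (intro Cons.IH) (auto intro: alt_bounded_max_starts)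
  then show ?case by simp
qed simp

text \<open>The stage of a relation makes the two sides incomparable in it, in both directions by
  symmetry, and later stages only shrink them.\<close>

lemma final_starts_incomparable:
  "\<forall>Q\<in>set Qs. alt_bounded K Q A B \<Longrightarrow> x \<in> final_starts Qs A B \<Longrightarrow> y \<in> final_starts Qs B A \<Longrightarrow>
   Q \<in> set Qs \<Longrightarrow> (x, y) \<notin> Q \<and> (y, x) \<notin> Q"
proof (induction Qs arbitrary: A B)
  case (Cons P Qs)
  have x: "x \<in> final_starts Qs (max_starts P A B) (max_starts P B A)"
    and y: "y \<in> final_starts Qs (max_starts P B A) (max_starts P A B)"
    using Cons.prems by simp_all
  show ?case
  proof (cases "Q = P")
    case True
    have "x \<in> max_starts P A B" "y \<in> max_starts P B A"
      using x y final_starts_subset by fast+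
    then show ?thesis
      using max_starts_incomparable[of K P] alt_bounded_swap Cons.prems(1) True
      by (metis list.set_intros(1))
  next
    case False
    then show ?thesis
      using Cons.prems x y by (intro Cons.IH) (auto intro: alt_bounded_max_starts)
  qed
qed simp

text \<open>Equal levels mean equal digits, so at each stage the longest chains of the smaller pair
  are longest chains of the larger one.\<close>

lemma final_starts_mono:
  assumes "\<forall>Q\<in>set Qs. alt_bounded K Q A' B'" "A \<union> B \<noteq> {}" "A \<subseteq> A'" "B \<subseteq> B'"
    "alt_level K Qs A B = alt_level K Qs A' B'"
  shows "final_starts Qs A B \<subseteq> final_starts Qs A' B'"
  using assms
proof (induction Qs arbitrary: A B A' B')
  case (Cons Q Qs)
  have bd: "alt_bounded K Q' A B" "alt_bounded K Q' A' B'" if "Q' \<in> set (Q # Qs)" for Q'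
    using Cons.prems(1,3,4) that alt_bounded_mono by blast+
  have ne': "A' \<union> B' \<noteq> {}" using Cons.prems by blast
  have ne: "max_starts Q A B \<union> max_starts Q B A \<noteq> {}" "max_starts Q A' B' \<union> max_starts Q B' A' \<noteq> {}"
    using max_starts_nonempty bd ne' Cons.prems(2) by (metis list.set_intros(1))+
  let ?l = "alt_level K Qs (max_starts Q A B) (max_starts Q B A)"
  let ?l' = "alt_level K Qs (max_starts Q A' B') (max_starts Q B' A')"
  have l: "?l < K ^ length Qs" "?l' < K ^ length Qs"
    using ne bd by (intro alt_level_less; auto intro: alt_bounded_max_starts)+
  have eq: "max_alt Q A B * K ^ length Qs + ?l = max_alt Q A' B' * K ^ length Qs + ?l'"
    using Cons.prems(5) by simp
  \<comment> \<open>The lower digits stay below \<open>K ^ length Qs\<close>, so division recovers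
    the leading one.\<close>
  have div: "(a * M + b) div M = a" if "b < M" for a b M :: nat using that by simp
  have m: "max_alt Q A B = max_alt Q A' B'"
    using div[OF l(1)] div[OF l(2)] eq by metis
  then have ll: "?l = ?l'" using eq by simp
  have sub: "max_starts Q A B \<subseteq> max_starts Q A' B'" "max_starts Q B A \<subseteq> max_starts Q B' A'"
    using max_starts_mono[OF Cons.prems(3,4) m]
      max_starts_mono[OF Cons.prems(4,3), of Q] m by (simp_all add: max_alt_swap[of Q B A] max_alt_swap[of Q B' A'])
  have "\<forall>Q'\<in>set Qs. alt_bounded K Q' (max_starts Q A' B') (max_starts Q B' A')"
    by (intro ballI alt_bounded_max_starts bd(2)) simp
  from Cons.IH[OF this ne(1) sub ll] show ?case by simp
qed simp

text \<open>Survivors on both sides would be distinct, hence comparable in some listed relation, yet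
  survivors are incomparable in all of them.\<close>

lemma final_starts_one_sided:
  assumes "\<forall>Q\<in>set Qs. alt_bounded K Q A B" "A \<inter> B = {}"
    "\<And>x y. x \<in> A \<Longrightarrow> y \<in> B \<Longrightarrow> x \<noteq> y \<Longrightarrow> \<exists>Q\<in>set Qs. (x, y) \<in> Q \<or> (y, x) \<in> Q"
  shows "final_starts Qs A B = {} \<or> final_starts Qs B A = {}"
proof (rule ccontr)
  assume "\<not> ?thesis"
  then obtain x y where x: "x \<in> final_starts Qs A B" and y: "y \<in> final_starts Qs B A" by blast
  have "x \<in> A" "y \<in> B" using x y final_starts_subset by fast+
  moreover from this have "x \<noteq> y" using assms(2) by blast
  ultimately obtain Q where "Q \<in> set Qs" "(x, y) \<in> Q \<or> (y, x) \<in> Q" using assms(3) by blast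
  then show False using final_starts_incomparable[OF assms(1) x y] by blast
qed

section \<open>Covers and comparability relations\<close>

text \<open>For finite \<open>V\<close> these are the nonempty superlevel sets of the absolute value
  of \<open>w\<close> at positive thresholds, split by the sign of \<open>w\<close>.\<close>

definition top_level :: "'a set \<Rightarrow> ('a \<Rightarrow> real) \<Rightarrow> 'a set \<Rightarrow> 'a set \<Rightarrow> bool" where
  "top_level V w A B \<longleftrightarrow> A \<subseteq> V \<and> B \<subseteq> V \<and> A \<union> B \<noteq> {} \<and> (\<forall>F\<in>A. 0 < w F) \<and> (\<forall>F\<in>B. w F < 0) \<and>
     (\<forall>F\<in>A \<union> B. \<forall>G\<in>V - (A \<union> B). \<bar>w G\<bar> < \<bar>w F\<bar>)"

lemma top_level_swap: "top_level V (\<lambda>F. - w F) A B \<longleftrightarrow> top_level V w B A"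
  by (auto simp: top_level_def Un_commute)

lemma top_level_disjoint: "top_level V w A B \<Longrightarrow> A \<inter> B = {}"
  by (force simp: top_level_def)

text \<open>Superlevel sets of one function are nested, and the sign of \<open>w\<close> decides the
  side of each member.\<close>

lemma top_level_nested:
  assumes "top_level V w A B" "top_level V w A' B'"
  shows "A \<subseteq> A' \<and> B \<subseteq> B' \<or> A' \<subseteq> A \<and> B' \<subseteq> B"
proof -
  have "A \<union> B \<subseteq> A' \<union> B' \<or> A' \<union> B' \<subseteq> A \<union> B"
  proof (rule ccontr)
    assume "\<not> ?thesis"
    then obtain F G where FG: "F \<in> A \<union> B" "F \<notin> A' \<union> B'" "G \<in> A' \<union> B'" "G \<notin> A \<union> B" by blast
    have outside: "\<bar>w G\<bar> < \<bar>w F\<bar>"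
      if "top_level V w C D" "F \<in> C \<union> D" "G \<in> V" "G \<notin> C \<union> D" for C D F G
      using that unfolding top_level_def by (metis DiffI)
    have "F \<in> V" "G \<in> V" using FG(1,3) assms by (auto simp: top_level_def)
    then have "\<bar>w G\<bar> < \<bar>w F\<bar>" "\<bar>w F\<bar> < \<bar>w G\<bar>"
      using outside[OF assms(1) FG(1) _ FG(4)] outside[OF assms(2) FG(3) _ FG(2)] by auto
    then show False by simp
  qed
  moreover have "C \<subseteq> C' \<and> D \<subseteq> D'"
    if "top_level V w C D" "top_level V w C' D'" "C \<union> D \<subseteq> C' \<union> D'" for C D C' D'
  proof (intro conjI subsetI)
    fix F assume F: "F \<in> C"
    then have "0 < w F" using that(1) by (simp add: top_level_def)
    moreover have "F \<notin> D'" using that(2) calculation by (auto simp: top_level_def)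
    ultimately show "F \<in> C'" using F that(3) by blast
  next
    fix F assume F: "F \<in> D"
    then have "w F < 0" using that(1) by (simp add: top_level_def)
    moreover have "F \<notin> C'" using that(2) calculation by (auto simp: top_level_def)
    ultimately show "F \<in> D'" using F that(3) by blast
  qed
  ultimately show ?thesis using assms by metis
qed

lemma ex_top_level:
  assumes "finite V" "F \<in> V" "w F \<noteq> 0"
  shows "\<exists>A B. top_level V w A B"
proof -
  \<comment> \<open>The topmost level, at the maximum of the absolute value, is enough.\<close>
  define m where "m = Max ((\<lambda>F. \<bar>w F\<bar>) ` V)"
  have le: "\<bar>w G\<bar> \<le> m" if "G \<in> V" for G using assms(1) that by (simp add: m_def)
  have m0: "m > 0" using le[OF assms(2)] assms(3) by linarith
  have "m \<in> (\<lambda>F. \<bar>w F\<bar>) ` V" unfolding m_def using assms by (intro Max_in) auto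
  then have ne: "{F \<in> V. w F = m} \<union> {F \<in> V. w F = - m} \<noteq> {}" by (auto simp: abs_if split: if_splits)
  have "\<bar>w G\<bar> < m" if "G \<in> V" "w G \<noteq> m" "w G \<noteq> - m" for G
    using le[OF that(1)] that(2,3) by (auto simp: abs_if split: if_splits)
  moreover have "\<bar>w F\<bar> = m" if "F \<in> {F \<in> V. w F = m} \<union> {F \<in> V. w F = - m}" for F
    using that m0 by auto
  ultimately have "top_level V w {F \<in> V. w F = m} {F \<in> V. w F = - m}"
    unfolding top_level_def using m0 ne by (intro conjI ballI) auto
  then show ?thesis by blast
qed

definition signed_value :: "'a set \<Rightarrow> ('a \<Rightarrow> real) \<Rightarrow> 'a \<Rightarrow> real" where
  "signed_value A w F = (if F \<in> A then w F else - w F)"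

text \<open>For finite \<open>V\<close> and the pairs summed in \<open>level_sum\<close>, this is
  positive exactly when \<open>(A, B)\<close> is a top level. Truncations and products keep it
  Lipschitz in the point on which \<open>w\<close> depends.\<close>

definition gap :: "'a set \<Rightarrow> 'a set \<Rightarrow> 'a set \<Rightarrow> ('a \<Rightarrow> real) \<Rightarrow> real" where
  "gap V A B w = (\<Prod>F\<in>A \<union> B. max 0 (signed_value A w F) *
     (\<Prod>G\<in>V - (A \<union> B). max 0 (signed_value A w F - \<bar>w G\<bar>)))"

lemma gap_nonneg: "0 \<le> gap V A B w"
  unfolding gap_def by (intro prod_nonneg mult_nonneg_nonneg ballI) auto

lemma gap_neq_0_iff:
  assumes "finite V" "A \<subseteq> V" "B \<subseteq> V" "A \<inter> B = {}" "A \<union> B \<noteq> {}"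
  shows "gap V A B w \<noteq> 0 \<longleftrightarrow> top_level V w A B"
proof -
  have fin: "finite (A \<union> B)" "finite (V - (A \<union> B))" using assms finite_subset by auto
  have max: "max 0 x \<noteq> 0 \<longleftrightarrow> 0 < x" for x :: real by auto
  have "gap V A B w \<noteq> 0 \<longleftrightarrow> (\<forall>F\<in>A \<union> B. 0 < signed_value A w F \<and>
      (\<forall>G\<in>V - (A \<union> B). 0 < signed_value A w F - \<bar>w G\<bar>))"
    unfolding gap_def using fin by (simp only: prod_zero_iff max mult_eq_0_iff de_Morgan_disj bex_simps ball_simps)
  also have "\<dots> \<longleftrightarrow> top_level V w A B"
  proof -
    have "signed_value A w F = w F" if "F \<in> A" for F using that by (simp add: signed_value_def)
    moreover have "signed_value A w F = - w F" if "F \<in> B" for F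
      using that assms(4) by (auto simp: signed_value_def)
    ultimately show ?thesis
      using assms(2-5) unfolding top_level_def ball_Un
      by (auto simp: abs_of_pos abs_of_neg)
  qed
  finally show ?thesis .
qed

text \<open>A coordinate of the test map before antisymmetrization. The condition on
  \<open>final_starts\<close> selects the orientation in which the first side survives.\<close>

definition level_sum :: "'a set \<Rightarrow> nat \<Rightarrow> 'a rel list \<Rightarrow> nat \<Rightarrow> ('a \<Rightarrow> real) \<Rightarrow> real" where
  "level_sum V K Qs l w =
     (\<Sum>(A, B) \<in> {(A, B). A \<subseteq> V \<and> B \<subseteq> V \<and> A \<inter> B = {} \<and> A \<union> B \<noteq> {} \<and>
        alt_level K Qs A B = l \<and> final_starts Qs A B \<noteq> {}}. gap V A B w)"

text \<open>
  The top levels of \<open>w\<close> form a chain, and those of equal alternation level carry the same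
  sign, so no cancellation occurs between the two sums.\<close>

lemma level_sum_sign:
  assumes fin: "finite V"
    and bd: "\<And>A B Q. top_level V w A B \<Longrightarrow> Q \<in> set Qs \<Longrightarrow> alt_bounded K Q A B"
    and comparable: "\<And>x y. x \<in> V \<Longrightarrow> y \<in> V \<Longrightarrow> x \<noteq> y \<Longrightarrow> \<exists>Q\<in>set Qs. (x, y) \<in> Q \<or> (y, x) \<in> Q"
    and top: "top_level V w A B" and final: "final_starts Qs A B \<noteq> {}"
  shows "level_sum V K Qs (alt_level K Qs A B) w \<noteq> level_sum V K Qs (alt_level K Qs A B) (\<lambda>F. - w F)"
proof -
  let ?I = "{(A', B'). A' \<subseteq> V \<and> B' \<subseteq> V \<and> A' \<inter> B' = {} \<and> A' \<union> B' \<noteq> {} \<and>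
        alt_level K Qs A' B' = alt_level K Qs A B \<and> final_starts Qs A' B' \<noteq> {}}"
  have finI: "finite ?I"
  proof (rule finite_subset)
    show "?I \<subseteq> Pow V \<times> Pow V" by (rule subsetI) clarsimp
  qed (simp add: fin)
  have AB: "A \<subseteq> V" "B \<subseteq> V" "A \<inter> B = {}" "A \<union> B \<noteq> {}"
    using top top_level_disjoint[OF top] by (simp_all add: top_level_def)
  have "0 < level_sum V K Qs (alt_level K Qs A B) w"
    unfolding level_sum_def
  proof (rule sum_pos2[OF finI, of "(A, B)"])
    have "gap V A B w \<noteq> 0" using gap_neq_0_iff[OF fin AB] top by blast
    then show "0 < (case (A, B) of (A, B) \<Rightarrow> gap V A B w)" using gap_nonneg[of V A B w] by simp
  qed (use AB final in \<open>simp_all add: gap_nonneg split_beta\<close>)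
  moreover have "level_sum V K Qs (alt_level K Qs A B) (\<lambda>F. - w F) = 0"
    unfolding level_sum_def
  proof (rule sum.neutral, rule ballI, rule ccontr)
    fix z
    assume z: "z \<in> ?I" and nz: "(case z of (A, B) \<Rightarrow> gap V A B (\<lambda>F. - w F)) \<noteq> 0"
    obtain A' B' where z_eq: "z = (A', B')" by (cases z)
    have I: "A' \<subseteq> V" "B' \<subseteq> V" "A' \<inter> B' = {}" "A' \<union> B' \<noteq> {}"
        "alt_level K Qs A' B' = alt_level K Qs A B" "final_starts Qs A' B' \<noteq> {}"
      using z unfolding z_eq by simp_all
    have gap: "gap V A' B' (\<lambda>F. - w F) \<noteq> 0" using nz by (simp add: z_eq)
    \<comment> \<open>A nonzero term for the negated weight comes from a pair whose swap is a top
      level of \<open>w\<close>, and swapping does not change the alternation level.\<close>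
    have top': "top_level V w B' A'"
      using gap gap_neq_0_iff[OF fin I(1-4)] by (simp add: top_level_swap)
    have lev: "alt_level K Qs B' A' = alt_level K Qs A B" using I(5) alt_level_swap by metis
    have one_sided: "final_starts Qs C D = {} \<or> final_starts Qs D C = {}" if "top_level V w C D" for C D
    proof (rule final_starts_one_sided)
      show "\<forall>Q\<in>set Qs. alt_bounded K Q C D" using bd[OF that] by blast
      show "C \<inter> D = {}" using that by (rule top_level_disjoint)
      fix x y assume "x \<in> C" "y \<in> D" "x \<noteq> y"
      moreover have "C \<subseteq> V" "D \<subseteq> V" using that by (simp_all add: top_level_def)
      ultimately show "\<exists>Q\<in>set Qs. (x, y) \<in> Q \<or> (y, x) \<in> Q"
        by (intro comparable) (rule subsetD; assumption)+
    qed
    \<comment> \<open>Of the two nested pairs the larger one would have survivors on both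
      sides.\<close>
    from top_level_nested[OF top top'] show False
    proof
      assume sub: "A \<subseteq> B' \<and> B \<subseteq> A'"
      have "\<forall>Q\<in>set Qs. alt_bounded K Q B' A'" using bd[OF top'] by blast
      then have "final_starts Qs A B \<subseteq> final_starts Qs B' A'"
        using AB(4) conjunct1[OF sub] conjunct2[OF sub] lev[symmetric] by (rule final_starts_mono)
      then show False using one_sided[OF top'] final I(6) by auto
    next
      assume sub: "B' \<subseteq> A \<and> A' \<subseteq> B"
      have "\<forall>Q\<in>set Qs. alt_bounded K Q B A" using bd[OF top] by (simp add: alt_bounded_swap[of K _ B A])
      moreover have "alt_level K Qs A' B' = alt_level K Qs B A" using I(5) alt_level_swap by metis
      ultimately have "final_starts Qs A' B' \<subseteq> final_starts Qs B A"
        using final_starts_mono[OF _ I(4) conjunct2[OF sub] conjunct1[OF sub]] by blast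
      then show False using one_sided[OF top] final I(6) by auto
    qed
  qed
  ultimately show ?thesis by simp
qed

section \<open>Distance functions and near realization\<close>

text \<open>The witness is the l1 distance to \<open>F\<close>; compactness makes the infimum
  attained, so that it vanishes only on \<open>F\<close>.\<close>

lemma nsphere_lipschitz_distance:
  assumes "closedin (nsphere n) F" "F \<noteq> {}"
  shows "\<exists>D. nsphere_lipschitz n D \<and> (\<forall>u\<in>topspace (nsphere n). 0 \<le> D u \<and> (D u = 0 \<longleftrightarrow> u \<in> F))"
proof -
  define D where "D = (\<lambda>u. Inf (l1_dist n u ` F))"
  have sub: "F \<subseteq> topspace (nsphere n)" using assms(1) by (rule closedin_subset)
  have "compact F"
    using assms(1) compact_nsphere nsphere_eq_top_of_set closedin_compact by metis
  have le: "D u \<le> l1_dist n u v" if "v \<in> F" for u v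
    unfolding D_def using that by (intro cInf_lower) (auto intro!: bdd_belowI[of _ 0])
  have att: "\<exists>v\<in>F. D u = l1_dist n u v" for u
  proof -
    obtain v where v: "v \<in> F" "\<forall>w\<in>F. l1_dist n u v \<le> l1_dist n u w"
      using continuous_attains_inf[OF \<open>compact F\<close> assms(2) continuous_on_l1_dist] by blast
    then have "D u = l1_dist n u v"
      unfolding D_def by (intro cInf_eq_minimum) auto
    then show ?thesis using v(1) by blast
  qed
  have diff: "D x - D y \<le> l1_dist n x y" for x y
  proof -
    obtain v where v: "v \<in> F" "D y = l1_dist n y v" using att by blast
    then show ?thesis using le[OF v(1), of x] l1_dist_triangle[of n x v y] by linarith
  qed
  have "nsphere_lipschitz n D"
  proof (rule nsphere_lipschitzI[of 1])
    fix x y show "\<bar>D x - D y\<bar> \<le> 1 * l1_dist n x y"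
      using diff[of x y] diff[of y x] by (simp add: l1_dist_commute abs_le_iff)
  qed simp
  moreover have "0 \<le> D u \<and> (D u = 0 \<longleftrightarrow> u \<in> F)" if u: "u \<in> topspace (nsphere n)" for u
  proof -
    obtain v where v: "v \<in> F" "D u = l1_dist n u v" using att by blast
    moreover have "l1_dist n u u = 0" by (simp add: l1_dist_def)
    ultimately show ?thesis
      using l1_dist_eq_0[OF u, of v] le[of u u] l1_dist_nonneg[of n u v] sub by fastforce
  qed
  ultimately show ?thesis by blast
qed

definition realized :: "nat \<Rightarrow> (nat \<Rightarrow> real) set set \<Rightarrow> (nat \<Rightarrow> real) set set \<Rightarrow> bool" where
  "realized n A B \<longleftrightarrow> (\<exists>u\<in>topspace (nsphere n). (\<forall>F\<in>A. u \<in> F) \<and> (\<forall>F\<in>B. - u \<in> F))"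

text \<open>If the pair is not realized, the sum of the distances is positive and by compactness at
  least some \<open>m > 0\<close>, so the distances cannot all be small.\<close>

lemma realized_if_near:
  assumes "finite A" "finite B"
    and lip: "\<And>F. F \<in> A \<union> B \<Longrightarrow> nsphere_lipschitz n (D F)"
    and D: "\<And>F u. F \<in> A \<union> B \<Longrightarrow> u \<in> topspace (nsphere n) \<Longrightarrow> 0 \<le> D F u \<and> (D F u = 0 \<longleftrightarrow> u \<in> F)"
  shows "\<exists>\<epsilon>>0. \<forall>u\<in>topspace (nsphere n).
     (\<forall>F\<in>A. D F u < \<epsilon>) \<and> (\<forall>F\<in>B. D F (- u) < \<epsilon>) \<longrightarrow> realized n A B"
proof (cases "realized n A B")
  case True
  then show ?thesis by (intro exI[of _ 1]) auto
next
  case False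
  let ?f = "\<lambda>u. (\<Sum>F\<in>A. D F u) + (\<Sum>F\<in>B. D F (- u))"
  have "nsphere_lipschitz n ?f"
    using lip by (intro lip_intros nsphere_lipschitz_reflect) auto
  then have cont: "continuous_on (topspace (nsphere n)) ?f"
    by (rule nsphere_lipschitz_imp_continuous)
  have pos: "0 < ?f u" if u: "u \<in> topspace (nsphere n)" for u
  proof -
    have nn: "0 \<le> (\<Sum>F\<in>A. D F u)" "0 \<le> (\<Sum>F\<in>B. D F (- u))"
      using D u by (auto intro!: sum_nonneg)
    have "\<not> ((\<forall>F\<in>A. u \<in> F) \<and> (\<forall>F\<in>B. - u \<in> F))"
      using False u unfolding realized_def by blast
    then consider F where "F \<in> A" "u \<notin> F" | F where "F \<in> B" "- u \<notin> F" by blast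
    then show ?thesis
    proof cases
      case 1
      then have "0 < D F u" using D[of F u] u by force
      then have "0 < (\<Sum>F\<in>A. D F u)" using 1 D u assms(1) by (intro sum_pos2[of _ F]) auto
      then show ?thesis using nn by linarith
    next
      case 2
      then have "0 < D F (- u)" using D[of F "- u"] u by force
      then have "0 < (\<Sum>F\<in>B. D F (- u))" using 2 D u assms(2) by (intro sum_pos2[of _ F]) auto
      then show ?thesis using nn by linarith
    qed
  qed
  obtain m where m: "m > 0" "\<forall>u\<in>topspace (nsphere n). m \<le> ?f u"
    using nsphere_pos_lower_bound[OF cont] pos by blast
  \<comment> \<open>The \<open>card A + card B\<close> distances, each below \<epsilon>, would add
    up to less than \<open>m\<close>; the \<open>+ 1\<close> makes this strict.\<close>
  define \<epsilon> where "\<epsilon> = m / (real (card A) + real (card B) + 1)"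
  have e0: "\<epsilon> > 0" using m(1) by (simp add: \<epsilon>_def)
  have False if u: "u \<in> topspace (nsphere n)" and near: "\<forall>F\<in>A. D F u < \<epsilon>" "\<forall>F\<in>B. D F (- u) < \<epsilon>" for u
  proof -
    have "(\<Sum>F\<in>A. D F u) \<le> (\<Sum>F\<in>A. \<epsilon>)" "(\<Sum>F\<in>B. D F (- u)) \<le> (\<Sum>F\<in>B. \<epsilon>)"
      by (rule sum_mono, use near in force)+
    then have "?f u \<le> (real (card A) + real (card B)) * \<epsilon>" by (simp add: algebra_simps)
    also have "\<dots> < m" using m(1) by (simp add: \<epsilon>_def divide_less_eq field_simps)
    finally show False using m(2) u by fastforce
  qed
  then show ?thesis using e0 by blast
qed

lemma uminus_uminus_fun: "- (- u) = (u :: 'a \<Rightarrow> real)"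
  by (simp add: fun_Compl_def)

text \<open>If \<open>n\<close> were at least the number of levels, Borsuk-Ulam would give a common
  zero \<open>u\<close> of the coordinates \<open>g u l\<close>. The cover provides a top level at
  \<open>u\<close>, and the coordinate at its alternation level is nonzero.\<close>

theorem cover_relation_bound:
  assumes cover: "n_cover n \<F>"
    and comparable: "\<And>x y. x \<in> \<F> \<Longrightarrow> y \<in> \<F> \<Longrightarrow> x \<noteq> y \<Longrightarrow> \<exists>Q\<in>set Qs. (x, y) \<in> Q \<or> (y, x) \<in> Q"
    and bd: "\<And>A B Q. A \<subseteq> \<F> \<Longrightarrow> B \<subseteq> \<F> \<Longrightarrow> realized n A B \<Longrightarrow> Q \<in> set Qs \<Longrightarrow> alt_bounded K Q A B"
  shows "n < K ^ length Qs"
proof (rule ccontr)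
  assume small: "\<not> n < K ^ length Qs"
  let ?S = "topspace (nsphere n)"
  \<comment> \<open>Distances are only taken to nonempty members; the union is unchanged.\<close>
  define V where "V = {F \<in> \<F>. F \<noteq> {}}"
  have V: "finite V" "V \<subseteq> \<F>" using cover by (auto simp: V_def n_cover_def)
  have "\<forall>F\<in>V. \<exists>D. nsphere_lipschitz n D \<and> (\<forall>u\<in>?S. 0 \<le> D u \<and> (D u = 0 \<longleftrightarrow> u \<in> F))"
    using cover nsphere_lipschitz_distance by (auto simp: V_def n_cover_def)
  from bchoice[OF this] obtain D where
    D: "\<forall>F\<in>V. nsphere_lipschitz n (D F) \<and> (\<forall>u\<in>?S. 0 \<le> D F u \<and> (D F u = 0 \<longleftrightarrow> u \<in> F))" ..
  have "\<forall>AB\<in>Pow V \<times> Pow V. \<exists>\<epsilon>>0. \<forall>u\<in>?S.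
     (\<forall>F\<in>fst AB. D F u < \<epsilon>) \<and> (\<forall>F\<in>snd AB. D F (- u) < \<epsilon>) \<longrightarrow> realized n (fst AB) (snd AB)"
  proof
    fix AB assume AB: "AB \<in> Pow V \<times> Pow V"
    then have "finite (fst AB)" "finite (snd AB)" using V(1) finite_subset by auto
    then show "\<exists>\<epsilon>>0. \<forall>u\<in>?S. (\<forall>F\<in>fst AB. D F u < \<epsilon>) \<and> (\<forall>F\<in>snd AB. D F (- u) < \<epsilon>)
        \<longrightarrow> realized n (fst AB) (snd AB)"
      by (rule realized_if_near) (use D AB in auto)
  qed
  from bchoice[OF this] obtain e where
    e: "\<forall>AB\<in>Pow V \<times> Pow V. e AB > 0 \<and> (\<forall>u\<in>?S.
     (\<forall>F\<in>fst AB. D F u < e AB) \<and> (\<forall>F\<in>snd AB. D F (- u) < e AB) \<longrightarrow> realized n (fst AB) (snd AB))" ..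
  \<comment> \<open>One threshold for all of the finitely many pairs.\<close>
  define \<epsilon> where "\<epsilon> = Min (e ` (Pow V \<times> Pow V))"
  have finP: "finite (e ` (Pow V \<times> Pow V))" "e ` (Pow V \<times> Pow V) \<noteq> {}" using V(1) by auto
  have e0: "\<epsilon> > 0" unfolding \<epsilon>_def using finP e by (simp add: Min_gr_iff)
  have near: "realized n A B" if "A \<subseteq> V" "B \<subseteq> V" "u \<in> ?S" "\<forall>F\<in>A. D F u < \<epsilon>" "\<forall>F\<in>B. D F (- u) < \<epsilon>" for A B u
  proof -
    have AB: "(A, B) \<in> Pow V \<times> Pow V" using that by simp
    then have "\<epsilon> \<le> e (A, B)" unfolding \<epsilon>_def using finP by (intro Min_le) auto
    moreover have "\<forall>u\<in>?S. (\<forall>F\<in>A. D F u < e (A, B)) \<and> (\<forall>F\<in>B. D F (- u) < e (A, B)) \<longrightarrow> realized n A B"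
      using e[rule_format, OF AB] by simp
    ultimately show ?thesis using that(3-5) by (meson order_less_le_trans)
  qed
  \<comment> \<open>The sign of \<open>w u F\<close> tells which of \<open>u\<close> and
    \<open>- u\<close> is closer to \<open>F\<close>; truncation makes a nonzero value imply that
    this point is within \<epsilon> of \<open>F\<close>.\<close>
  define w where "w = (\<lambda>u F. max 0 (\<epsilon> - D F u) - max 0 (\<epsilon> - D F (- u)))"
  have w_odd: "w (- u) = (\<lambda>F. - w u F)" for u by (simp add: w_def uminus_uminus_fun)
  have w_lip: "nsphere_lipschitz n (\<lambda>u. w u F)" if "F \<in> V" for F
    unfolding w_def using D that by (intro lip_intros nsphere_lipschitz_reflect) auto
  \<comment> \<open>The factor \<open>s\<close> serves both the weight and its negative.\<close>
  have gap_lip: "nsphere_lipschitz n (\<lambda>u. gap V A B (\<lambda>F. s * w u F))" if "A \<subseteq> V" "B \<subseteq> V" for A B s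
  proof -
    have "nsphere_lipschitz n (\<lambda>u. signed_value A (\<lambda>F. s * w u F) F)" if "F \<in> V" for F
      using w_lip[OF that] by (cases "F \<in> A") (auto simp: signed_value_def intro!: lip_intros)
    then show ?thesis
      unfolding gap_def using that w_lip by (intro lip_intros) auto
  qed
  have sum_lip: "nsphere_lipschitz n (\<lambda>u. level_sum V K Qs l (\<lambda>F. s * w u F))" for l s
    unfolding level_sum_def case_prod_unfold
    by (rule nsphere_lipschitz_sum) (auto intro!: gap_lip)
  define g where "g = (\<lambda>u l. level_sum V K Qs l (w u) - level_sum V K Qs l (\<lambda>F. - w u F))"
  obtain u where u: "u \<in> ?S" "\<forall>l<K ^ length Qs. g u l = 0"
  proof -
    have "\<exists>u\<in>?S. \<forall>l<K ^ length Qs. g u l = 0"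
    proof (rule Borsuk_Ulam_lipschitz)
      show "K ^ length Qs \<le> n" using small by simp
      fix l
      show "nsphere_lipschitz n (\<lambda>u. g u l)"
        unfolding g_def using sum_lip[of l 1] sum_lip[of l "- 1"] by (auto intro: nsphere_lipschitz_diff)
      show "g (- u) l = - g u l" for u by (simp add: g_def w_odd)
    qed
    then show ?thesis using that by blast
  qed
  have uS': "- u \<in> ?S" using u(1) by simp
  obtain F where F: "F \<in> \<F>" "u \<in> F" using cover u(1) by (auto simp: n_cover_def)
  then have FV: "F \<in> V" by (auto simp: V_def)
  \<comment> \<open>Antipodal-freeness makes \<open>w u F\<close> nonzero: \<open>F\<close> contains
    \<open>u\<close> but not \<open>- u\<close>.\<close>
  have "- u \<notin> F"
  proof
    assume "- u \<in> F"
    then have "u \<in> uminus ` F" by (metis imageI uminus_uminus_fun)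
    then show False using F cover by (auto simp: n_cover_def antipodal_free_def)
  qed
  moreover have "0 \<le> D F u \<and> (D F u = 0 \<longleftrightarrow> u \<in> F)" "0 \<le> D F (- u) \<and> (D F (- u) = 0 \<longleftrightarrow> - u \<in> F)"
    using D FV u(1) uS' by blast+
  ultimately have "D F u = 0" "D F (- u) > 0" using F(2) by auto
  then have "w u F \<noteq> 0" using e0 by (auto simp: w_def)
  then obtain A B where top: "top_level V (w u) A B" using ex_top_level[OF V(1) FV] by blast
  have bd': "alt_bounded K Q A B" if t: "top_level V (w u) A B" and Q: "Q \<in> set Qs" for A B Q
  proof -
    have AB: "A \<subseteq> V" "B \<subseteq> V" using t by (auto simp: top_level_def)
    have "D F u < \<epsilon>" if "F \<in> A" for F
    proof -
      have "0 < w u F" using t that by (simp add: top_level_def)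
      then show ?thesis unfolding w_def by linarith
    qed
    moreover have "D F (- u) < \<epsilon>" if "F \<in> B" for F
    proof -
      have "w u F < 0" using t that by (simp add: top_level_def)
      then show ?thesis unfolding w_def by linarith
    qed
    ultimately have "realized n A B" using near[OF AB u(1)] by blast
    then show ?thesis using AB V(2) Q by (intro bd) auto
  qed
  have comparable': "\<exists>Q\<in>set Qs. (x, y) \<in> Q \<or> (y, x) \<in> Q" if "x \<in> V" "y \<in> V" "x \<noteq> y" for x y
    using that V(2) by (intro comparable) auto
  have ABne: "A \<union> B \<noteq> {}" using top by (simp add: top_level_def)
  have bdAB: "\<forall>Q\<in>set Qs. alt_bounded K Q A B" using bd'[OF top] by blast
  have "g u (alt_level K Qs A B) = 0"
    using u(2) alt_level_less[OF bdAB ABne] by blast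
  then have eq: "level_sum V K Qs (alt_level K Qs A B) (w u) = level_sum V K Qs (alt_level K Qs A B) (\<lambda>F. - w u F)"
    by (simp add: g_def)
  consider "final_starts Qs A B \<noteq> {}" | "final_starts Qs B A \<noteq> {}"
    using final_starts_nonempty[OF bdAB ABne] by blast
  then show False
  proof cases
    case 1
    show False using level_sum_sign[OF V(1) bd' comparable' top 1] eq by simp
  next
    case 2
    \<comment> \<open>When the negative side survives, the same argument runs for the negated weight
      and the swapped pair.\<close>
    have bd'': "alt_bounded K Q A B" if "top_level V (\<lambda>F. - w u F) A B" "Q \<in> set Qs" for A B Q
      using bd'[of B A Q] that by (simp add: top_level_swap alt_bounded_swap[of K Q A B])
    have top': "top_level V (\<lambda>F. - w u F) B A" using top by (simp add: top_level_swap)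
    show False
      using level_sum_sign[OF V(1) bd'' comparable' top' 2] eq alt_level_swap[of K Qs A B] by simp
  qed
qed

section \<open>Monotone alternating patterns\<close>

lemma alt_chain_sequence:
  assumes "alt_chain Q A B k x"
  shows "\<exists>F. F 1 = x \<and> (\<forall>i\<in>{1..Suc k}. F i \<in> (if odd i then A else B)) \<and>
     (\<forall>i\<in>{1..<Suc k}. (F i, F (i + 1)) \<in> Q)"
  using assms
proof (induction k arbitrary: x A B)
  case 0
  then show ?case by (intro exI[of _ "\<lambda>_. x"]) auto
next
  case (Suc k)
  from Suc.prems obtain y where y: "x \<in> A" "(x, y) \<in> Q" "alt_chain Q B A k y" by auto
  from Suc.IH[OF y(3)] obtain F where F: "F 1 = y"
      "\<forall>i\<in>{1..Suc k}. F i \<in> (if odd i then B else A)" "\<forall>i\<in>{1..<Suc k}. (F i, F (i + 1)) \<in> Q"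
    by blast
  define F' where "F' = (\<lambda>i. if i \<le> 1 then x else F (i - 1))"
  have "F' i \<in> (if odd i then A else B)" if i: "i \<in> {1..Suc (Suc k)}" for i
  proof (cases "i = 1")
    case False
    then obtain j where j: "i = Suc j" "j \<in> {1..Suc k}" using i by (cases i) auto
    then show ?thesis using F(2)[rule_format, OF j(2)] by (simp add: F'_def split: if_splits)
  qed (simp add: F'_def y)
  moreover have "(F' i, F' (i + 1)) \<in> Q" if i: "i \<in> {1..<Suc (Suc k)}" for i
  proof (cases "i = 1")
    case False
    then obtain j where j: "i = Suc j" "j \<in> {1..<Suc k}" using i by (cases i) auto
    then show ?thesis using F(3)[rule_format, OF j(2)] by (simp add: F'_def)
  qed (use y F(1) in \<open>simp add: F'_def\<close>)
  ultimately show ?case by (intro exI[of _ F']) (simp add: F'_def)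
qed

lemma in_signed_minus_1: "u \<in> signed (- 1) F \<longleftrightarrow> - u \<in> F"
proof
  assume "- u \<in> F"
  then show "u \<in> signed (- 1) F" unfolding signed_minus_1 by (metis imageI uminus_uminus_fun)
qed (auto simp: signed_minus_1 uminus_uminus_fun)

lemma in_signed_alternating:
  "u \<in> signed ((- 1) ^ i) F \<longleftrightarrow> (if even i then u \<in> F else - u \<in> F)"
  by (simp add: signed_1 in_signed_minus_1)

lemma alternating_atI:
  assumes "\<forall>F\<in>A. u \<in> F" "\<forall>F\<in>B. - u \<in> F"
    and "(\<forall>i\<in>{1..k}. F i \<in> (if odd i then A else B)) \<or> (\<forall>i\<in>{1..k}. F i \<in> (if odd i then B else A))"
  shows "alternating_at u k F"
  using assms(3)
proof
  assume F: "\<forall>i\<in>{1..k}. F i \<in> (if odd i then A else B)"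
  have "u \<in> signed ((- 1) ^ (i - 1)) (F i)" if i: "i \<in> {1..k}" for i
  proof -
    have "even (i - 1) \<longleftrightarrow> odd i" using i by simp
    then show ?thesis
      using F[rule_format, OF i] assms(1,2) unfolding in_signed_alternating by (auto split: if_splits)
  qed
  then show ?thesis unfolding alternating_at_def by blast
next
  assume F: "\<forall>i\<in>{1..k}. F i \<in> (if odd i then B else A)"
  have "u \<in> signed ((- 1) ^ i) (F i)" if i: "i \<in> {1..k}" for i
    using F[rule_format, OF i] assms(1,2) unfolding in_signed_alternating by (auto split: if_splits)
  then show ?thesis unfolding alternating_at_def by blast
qed

section \<open>Refining the orders by signs\<close>

text \<open>\<open>s\<close> is the set of orders that agree with the first. Fixing the direction of
  \<open>r 1\<close> leaves \<open>2 ^ (d - 1)\<close> choices of \<open>s\<close> within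
  \<open>{2..d}\<close>.\<close>

definition sign_rel :: "(nat \<Rightarrow> 'a rel) \<Rightarrow> nat \<Rightarrow> nat set \<Rightarrow> 'a rel" where
  "sign_rel r d s = {(x, y). (x, y) \<in> r 1 \<and> (\<forall>j\<in>{2..d}. if j \<in> s then (x, y) \<in> r j else (y, x) \<in> r j)}"

lemma monotone_wrt_sign_rel:
  assumes "\<forall>i\<in>{1..<k}. (F i, F (i + 1)) \<in> sign_rel r d s" "j \<in> {1..d}"
  shows "monotone_wrt (r j) k F"
proof -
  consider "j = 1" | "j \<in> {2..d}" "j \<in> s" | "j \<in> {2..d}" "j \<notin> s" using assms(2) by fastforce
  then show ?thesis
    using assms(1) unfolding monotone_wrt_def sign_rel_def by cases fastforce+
qed

text \<open>Orient the pair upwards in \<open>r 1\<close> and let \<open>s\<close> collect the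
  orders that agree.\<close>

lemma sign_rel_comparable:
  assumes "\<forall>j\<in>{1..d}. linear_order_on V (r j)" "d \<ge> 1" "x \<in> V" "y \<in> V" "x \<noteq> y"
  shows "\<exists>s\<in>Pow {2..d}. (x, y) \<in> sign_rel r d s \<or> (y, x) \<in> sign_rel r d s"
proof -
  have tot: "(a, b) \<in> r j \<or> (b, a) \<in> r j" if "a \<in> V" "b \<in> V" "a \<noteq> b" "j \<in> {1..d}" for a b j
    using assms(1) that unfolding linear_order_on_def total_on_def by blast
  have "(a, b) \<in> sign_rel r d {j \<in> {2..d}. (a, b) \<in> r j}" if "a \<in> V" "b \<in> V" "a \<noteq> b" "(a, b) \<in> r 1" for a b
  proof -
    have "(b, a) \<in> r j" if "j \<in> {2..d}" "(a, b) \<notin> r j" for j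
      using tot[OF \<open>a \<in> V\<close> \<open>b \<in> V\<close> \<open>a \<noteq> b\<close>, of j] that by auto
    then show ?thesis using that(4) by (simp add: sign_rel_def)
  qed
  moreover have "(x, y) \<in> r 1 \<or> (y, x) \<in> r 1" using tot[of x y 1] assms by simp
  ultimately show ?thesis using assms(3-5) by blast
qed

text \<open>If all patterns have fewer than \<open>c\<close> members, chains in every refined
  relation are bounded by \<open>K\<close>, so \<open>n < K ^ M\<close>; but \<open>K < c\<close>
  gives \<open>K ^ M < (n + 1) / 2\<close>.\<close>

theorem ex_monotone_alternating:
  assumes d: "d \<ge> 1" and cover: "n_cover n \<F>" and lin: "\<forall>j\<in>{1..d}. linear_order_on \<F> (r j)"
  shows "\<exists>u\<in>topspace (nsphere n). \<exists>(k :: nat) F.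
           real k \<ge> ((real n + 1) / 2) powr (1 / 2 ^ (d - 1)) \<and>
           (\<forall>i\<in>{1..k}. F i \<in> \<F>) \<and> alternating_at u k F \<and> (\<forall>j\<in>{1..d}. monotone_wrt (r j) k F)"
proof (rule ccontr)
  assume none: "\<not> ?thesis"
  define M where "M = (2 :: nat) ^ (d - 1)"
  define c where "c = ((real n + 1) / 2) powr (1 / real M)"
  \<comment> \<open>The largest integer strictly below \<open>c\<close>. A chain of \<open>k\<close>
    steps is a pattern of \<open>k + 1 < c\<close> members, hence \<open>k < K\<close>.\<close>
  define K where "K = nat (\<lceil>c\<rceil> - 1)"
  have c0: "c > 0" by (simp add: c_def)
  have bound: "real k < c" if "u \<in> topspace (nsphere n)" "\<forall>i\<in>{1..k}. F i \<in> \<F>" "alternating_at u k F"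
      "\<forall>j\<in>{1..d}. monotone_wrt (r j) k F" for u k F
    using none that by (force simp: c_def M_def not_le)
  obtain ss where ss: "set ss = Pow {2..d}" "distinct ss"
    using finite_distinct_list[of "Pow {2..d}"] by auto
  have "length ss = card (Pow {2..d})" using distinct_card[OF ss(2)] ss(1) by simp
  then have len: "length ss = M" using d by (simp add: card_Pow M_def numeral_2_eq_2)
  have "n < K ^ length (map (sign_rel r d) ss)"
  proof (rule cover_relation_bound[OF cover])
    fix x y assume "x \<in> \<F>" "y \<in> \<F>" "x \<noteq> y"
    then show "\<exists>Q\<in>set (map (sign_rel r d) ss). (x, y) \<in> Q \<or> (y, x) \<in> Q"
      using sign_rel_comparable[OF lin d] by (simp add: ss(1))
  next
    fix A B Q
    assume AB: "A \<subseteq> \<F>" "B \<subseteq> \<F>" and real: "realized n A B" and Q: "Q \<in> set (map (sign_rel r d) ss)"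
    obtain s where s: "Q = sign_rel r d s" using Q by auto
    obtain u where u: "u \<in> topspace (nsphere n)" "\<forall>F\<in>A. u \<in> F" "\<forall>F\<in>B. - u \<in> F"
      using real unfolding realized_def by blast
    show "alt_bounded K Q A B"
      unfolding alt_bounded_def
    proof (intro allI impI)
      fix k x assume "alt_chain Q A B k x \<or> alt_chain Q B A k x"
      then obtain F where F: "\<forall>i\<in>{1..<Suc k}. (F i, F (i + 1)) \<in> Q"
        "(\<forall>i\<in>{1..Suc k}. F i \<in> (if odd i then A else B)) \<or>
         (\<forall>i\<in>{1..Suc k}. F i \<in> (if odd i then B else A))"
        using alt_chain_sequence by metis
      have "alternating_at u (Suc k) F" by (rule alternating_atI[OF u(2,3) F(2)])
      moreover have "\<forall>j\<in>{1..d}. monotone_wrt (r j) (Suc k) F"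
        using F(1) unfolding s by (blast intro: monotone_wrt_sign_rel)
      moreover have "\<forall>i\<in>{1..Suc k}. F i \<in> \<F>" using F(2) AB by (auto split: if_splits)
      ultimately have "real (Suc k) < c" by (intro bound[OF u(1)]) auto
      then show "k < K" unfolding K_def by linarith
    qed
  qed
  then have "n < K ^ M" by (simp add: len)
  then have "K > 0" by (cases "K = 0") (simp_all add: M_def power_0_left)
  then have "real K < c" unfolding K_def by linarith
  then have "real K ^ M < c ^ M" by (intro power_strict_mono) (auto simp: M_def)
  also have "c ^ M = c powr real M" using c0 by (simp add: powr_realpow)
  also have "\<dots> = (real n + 1) / 2" by (simp add: c_def powr_powr M_def)
  finally have "real (K ^ M) < (real n + 1) / 2" by simp
  moreover have "real (n + 1) \<le> real (K ^ M)" using \<open>n < K ^ M\<close> by (simp only: of_nat_le_iff)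
  ultimately show False by simp
qed

section \<open>Sharpness\<close>

lemma lex_less: "a < a' \<Longrightarrow> b < N \<Longrightarrow> a * N + b < a' * N + (b' :: nat)"
proof -
  assume "a < a'" "b < N"
  then have "Suc a * N \<le> a' * N" by (intro mult_right_mono) auto
  then show ?thesis using \<open>b < N\<close> by simp
qed

lemma lex_le_imp_le: "a * N + b \<le> a' * N + b' \<Longrightarrow> b' < N \<Longrightarrow> a \<le> (a' :: nat)"
  using lex_less[of a' a b' N b] by (metis linorder_not_le)

lemma inj_on_lex:
  assumes "inj_on f {..<N}" "inj_on g {..<N}" "g ` {..<N} \<subseteq> {..<N}"
  shows "inj_on (\<lambda>z. f (z div N) * N + g (z mod N)) {..<N * (N :: nat)}"
proof (rule inj_onI)
  fix y z
  assume y: "y \<in> {..<N * N}" and z: "z \<in> {..<N * N}"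
    and eq: "f (y div N) * N + g (y mod N) = f (z div N) * N + g (z mod N)"
  have N: "N > 0" using y by (cases N) auto
  have lt: "y div N < N" "z div N < N" "y mod N < N" "z mod N < N"
    using y z N by (auto simp: less_mult_imp_div_less)
  have g: "g (y mod N) < N" "g (z mod N) < N" using assms(3) lt(3,4) by blast+
  have fe: "f (y div N) = f (z div N)"
    using lex_le_imp_le[of _ N _ _ "g (z mod N)"] lex_le_imp_le[of _ N _ _ "g (y mod N)"] eq g
    by (metis order_antisym order_refl)
  then have "y div N = z div N" using assms(1) lt by (auto dest: inj_onD)
  moreover have "y mod N = z mod N" using assms(2) lt eq fe by (auto dest: inj_onD)
  ultimately show "y = z" by (metis div_mult_mod_eq)
qed

text \<open>Orders on \<open>{..<N}\<close> are given by numerical keys. Only neighbours must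
  differ, which is what alternation guarantees for members of a cover.\<close>

definition short_monotone :: "nat \<Rightarrow> nat \<Rightarrow> nat \<Rightarrow> (nat \<Rightarrow> nat \<Rightarrow> nat) \<Rightarrow> bool" where
  "short_monotone d N q f \<longleftrightarrow>
     (\<forall>k x. (\<forall>i\<in>{1..k}. x i < N) \<longrightarrow> (\<forall>i\<in>{1..<k}. x i \<noteq> x (i + 1)) \<longrightarrow>
        (\<forall>j\<in>{1..d}. (\<forall>i\<in>{1..<k}. f j (x i) \<le> f j (x (i + 1))) \<or>
                    (\<forall>i\<in>{1..<k}. f j (x (i + 1)) \<le> f j (x i))) \<longrightarrow> k \<le> q)"

text \<open>A monotone sequence with distinct neighbours is strictly monotone, so it exhausts
  \<open>{..<q}\<close> after at most \<open>q\<close> terms.\<close>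

lemma short_monotone_1: "short_monotone 1 q q (\<lambda>j x. x)"
  unfolding short_monotone_def
proof (intro allI impI)
  fix k :: nat and x :: "nat \<Rightarrow> nat"
  assume lt: "\<forall>i\<in>{1..k}. x i < q" and ne: "\<forall>i\<in>{1..<k}. x i \<noteq> x (i + 1)"
    and mono: "\<forall>j\<in>{1..1::nat}. (\<forall>i\<in>{1..<k}. x i \<le> x (i + 1)) \<or> (\<forall>i\<in>{1..<k}. x (i + 1) \<le> x i)"
  show "k \<le> q"
  proof (cases "k = 0")
    case False
    from mono have "(\<forall>i\<in>{1..<k}. x i \<le> x (i + 1)) \<or> (\<forall>i\<in>{1..<k}. x (i + 1) \<le> x i)" by auto
    then show ?thesis
    proof
      assume up: "\<forall>i\<in>{1..<k}. x i \<le> x (i + 1)"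
      have "i < k \<Longrightarrow> i \<le> x (i + 1)" for i
      proof (induction i)
        case (Suc i)
        then have "i \<le> x (Suc i)" "x (Suc i) < x (Suc (Suc i))"
          using up ne by (auto simp: order.strict_iff_order)
        then show ?case by simp
      qed simp
      from this[of "k - 1"] lt[rule_format, of k] False show ?thesis by simp
    next
      assume down: "\<forall>i\<in>{1..<k}. x (i + 1) \<le> x i"
      have "i < k \<Longrightarrow> x (i + 1) + i \<le> x 1" for i
      proof (induction i)
        case (Suc i)
        then have "x (Suc i) + i \<le> x 1" by simp
        moreover have "x (Suc i + 1) \<le> x (Suc i)" "x (Suc i) \<noteq> x (Suc i + 1)"
          using down ne Suc.prems by auto
        ultimately show ?case by simp
      qed simp
      from this[of "k - 1"] lt[rule_format, of 1] False show ?thesis by simp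
    qed
  qed simp
qed

text \<open>
  Doubling: on pairs in lexicographic order, the new order agrees with the first one on the first
  component and reverses it on the second. So along a monotone sequence either
  the first component always changes or it never does.\<close>

lemma ex_short_monotone:
  assumes "d \<ge> 1" "N = q ^ 2 ^ (d - 1)"
  shows "\<exists>f. (\<forall>j\<in>{1..d}. inj_on (f j) {..<N} \<and> f j ` {..<N} \<subseteq> {..<N}) \<and> short_monotone d N q f"
  using assms
proof (induction d arbitrary: N rule: nat_induct_at_least)
  case base
  then show ?case using short_monotone_1[of q] by (intro exI[of _ "\<lambda>j x. x"]) auto
next
  case (Suc d)
  define N0 where "N0 = q ^ 2 ^ (d - 1)"
  \<comment> \<open>\<open>N\<close> is squared when \<open>d\<close> grows by one, while the bound
    \<open>q\<close> stays the same.\<close>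
  have "2 * 2 ^ (d - 1) = (2 :: nat) ^ d" using Suc.hyps by (simp flip: power_Suc)
  then have N: "N = N0 * N0"
    using Suc.prems by (simp add: N0_def power_mult mult_2 flip: power_add)
  from Suc.IH[OF N0_def] obtain f where
    f: "\<And>j. j \<in> {1..d} \<Longrightarrow> inj_on (f j) {..<N0}" "\<And>j. j \<in> {1..d} \<Longrightarrow> f j ` {..<N0} \<subseteq> {..<N0}"
    and short: "short_monotone d N0 q f" by blast
  have d1: "1 \<in> {1..d}" using Suc.hyps by simp
  \<comment> \<open>The key opposite to \<open>f 1\<close>.\<close>
  define h where "h = (\<lambda>b. N0 - 1 - f 1 b)"
  have f_lt: "f j b < N0" if "j \<in> {1..d}" "b < N0" for j b using f(2)[OF that(1)] that(2) by auto
  have h_range: "h ` {..<N0} \<subseteq> {..<N0}" by (auto simp: h_def)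
  have h_lt: "h b < N0" if "b < N0" for b using that by (simp add: h_def)
  have h_inj: "inj_on h {..<N0}"
  proof (rule inj_onI)
    fix a b assume ab: "a \<in> {..<N0}" "b \<in> {..<N0}" "h a = h b"
    then have "f 1 a = f 1 b" using f_lt[OF d1, of a] f_lt[OF d1, of b] by (simp add: h_def)
    then show "a = b" using f(1)[OF d1] ab by (auto dest: inj_onD)
  qed
  define g where "g = (\<lambda>j z. if j = Suc d then f 1 (z div N0) * N0 + h (z mod N0)
                              else f j (z div N0) * N0 + f j (z mod N0))"
  have "inj_on (g j) {..<N} \<and> g j ` {..<N} \<subseteq> {..<N}" if j: "j \<in> {1..Suc d}" for j
  proof
    show "inj_on (g j) {..<N}"
      using j inj_on_lex[OF f(1)[OF d1] h_inj h_range] inj_on_lex[OF f(1) f(1) f(2), of j j]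
      by (cases "j = Suc d") (auto simp: g_def[abs_def] N)
    show "g j ` {..<N} \<subseteq> {..<N}"
    proof (rule image_subsetI)
      fix z assume z: "z \<in> {..<N}"
      then have N0: "N0 > 0" by (cases N0) (auto simp: N)
      have zz: "z div N0 < N0" "z mod N0 < N0" using z N0 by (auto simp: N less_mult_imp_div_less)
      obtain a b where ab: "g j z = a * N0 + b" "a < N0" "b < N0"
        using j f_lt[OF _ zz(1), of j] f_lt[OF d1 zz(1)] f_lt[OF _ zz(2), of j] h_lt[OF zz(2)]
        by (cases "j = Suc d") (auto simp: g_def)
      then show "g j z \<in> {..<N}" using lex_less[of a N0 b N0 0] by (simp add: N)
    qed
  qed
  moreover have "short_monotone (Suc d) N q g"
    unfolding short_monotone_def
  proof (intro allI impI)
    fix k :: nat and x :: "nat \<Rightarrow> nat"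
    assume lt: "\<forall>i\<in>{1..k}. x i < N" and ne: "\<forall>i\<in>{1..<k}. x i \<noteq> x (i + 1)"
      and mono: "\<forall>j\<in>{1..Suc d}. (\<forall>i\<in>{1..<k}. g j (x i) \<le> g j (x (i + 1))) \<or>
                                 (\<forall>i\<in>{1..<k}. g j (x (i + 1)) \<le> g j (x i))"
    define a where "a = (\<lambda>i. x i div N0)"
    define b where "b = (\<lambda>i. x i mod N0)"
    have ab_lt: "a i < N0" "b i < N0" if i: "i \<in> {1..k}" for i
    proof -
      have "x i < N0 * N0" using lt i by (simp add: N)
      then show "a i < N0" "b i < N0"
        by (cases N0; simp add: a_def b_def less_mult_imp_div_less)+
    qed
    have gj: "g j (x i) = f j (a i) * N0 + f j (b i)" if "j \<in> {1..d}" for i j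
      using that by (simp add: g_def a_def b_def)
    have gd: "g (Suc d) (x i) = f 1 (a i) * N0 + h (b i)" for i
      by (simp add: g_def a_def b_def)
    have step: "i \<in> {1..k}" "i + 1 \<in> {1..k}" if "i \<in> {1..<k}" for i using that by auto
    have b_ne: "b i \<noteq> b (i + 1)" if "i \<in> {1..<k}" "a i = a (i + 1)" for i
    proof
      assume "b i = b (i + 1)"
      then have "x i = x (i + 1)" using that(2) unfolding a_def b_def by (metis div_mult_mod_eq)
      then show False using ne that(1) by blast
    qed
    have f1_b: "f 1 (b i) \<noteq> f 1 (b (i + 1))" if i: "i \<in> {1..<k}" "a i = a (i + 1)" for i
      using b_ne[OF i] inj_onD[OF f(1)[OF d1], of "b i" "b (i + 1)"] ab_lt step[OF i(1)] by auto
    have f1_a: "f 1 (a i) \<noteq> f 1 (a (i + 1))" if i: "i \<in> {1..<k}" "a i \<noteq> a (i + 1)" for i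
      using i(2) inj_onD[OF f(1)[OF d1], of "a i" "a (i + 1)"] ab_lt step[OF i(1)] by auto
    have h_rev: "h y \<le> h z \<longleftrightarrow> f 1 z \<le> f 1 y" if "y < N0" "z < N0" for y z
      using f_lt[OF d1 that(1)] f_lt[OF d1 that(2)] by (auto simp: h_def)
    have fst_mono: "f j (a i) \<le> f j (a i')"
      if "j \<in> {1..d}" "i \<in> {1..k}" "i' \<in> {1..k}" "g j (x i) \<le> g j (x i')" for j i i'
      using that(4) lex_le_imp_le f_lt[OF that(1) ab_lt(2)[OF that(3)]] unfolding gj[OF that(1)] by blast
    have fst_mono': "f 1 (a i) \<le> f 1 (a i')"
      if "i \<in> {1..k}" "i' \<in> {1..k}" "g (Suc d) (x i) \<le> g (Suc d) (x i')" for i i'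
      using that(3) lex_le_imp_le[of _ _ _ _ "h (b i')"] h_range ab_lt(2)[OF that(2)] unfolding gd by blast
    have snd_mono: "f j (b i) \<le> f j (b i')"
      if "j \<in> {1..d}" "a i = a i'" "g j (x i) \<le> g j (x i')" for j i i'
      using that(2,3) unfolding gj[OF that(1)] by simp
    have snd_mono': "f 1 (b i') \<le> f 1 (b i)"
      if "i \<in> {1..k}" "i' \<in> {1..k}" "a i = a i'" "g (Suc d) (x i) \<le> g (Suc d) (x i')" for i i'
      using that(3,4) h_rev[OF ab_lt(2)[OF that(1)] ab_lt(2)[OF that(2)]] unfolding gd by simp
    have m1: "(\<forall>i\<in>{1..<k}. g 1 (x i) \<le> g 1 (x (i + 1))) \<or> (\<forall>i\<in>{1..<k}. g 1 (x (i + 1)) \<le> g 1 (x i))"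
      and m2: "(\<forall>i\<in>{1..<k}. g (Suc d) (x i) \<le> g (Suc d) (x (i + 1))) \<or>
               (\<forall>i\<in>{1..<k}. g (Suc d) (x (i + 1)) \<le> g (Suc d) (x i))"
      using mono d1 by simp_all
    \<comment> \<open>If \<open>g 1\<close> and \<open>g (Suc d)\<close> move in the same direction,
      a step fixing \<open>a\<close> would move \<open>f 1 (b i)\<close> weakly both ways, hence fix
      it. If they move in opposite directions, the same holds of \<open>f 1 (a i)\<close>, so
      \<open>a\<close> never changes.\<close>
    have "(\<forall>i\<in>{1..<k}. a i \<noteq> a (i + 1)) \<or> (\<forall>i\<in>{1..<k}. a i = a (i + 1))"
      using m1
    proof
      assume up: "\<forall>i\<in>{1..<k}. g 1 (x i) \<le> g 1 (x (i + 1))"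
      from m2 show ?thesis
      proof
        assume up': "\<forall>i\<in>{1..<k}. g (Suc d) (x i) \<le> g (Suc d) (x (i + 1))"
        have "a i \<noteq> a (i + 1)" if i: "i \<in> {1..<k}" for i
          using snd_mono[OF d1, of i "i + 1"] snd_mono'[OF step[OF i]] f1_b[OF i] up up' i
          by (metis order_antisym)
        then show ?thesis by blast
      next
        assume down': "\<forall>i\<in>{1..<k}. g (Suc d) (x (i + 1)) \<le> g (Suc d) (x i)"
        have "a i = a (i + 1)" if i: "i \<in> {1..<k}" for i
          using fst_mono[OF d1 step[OF i]] fst_mono'[OF step(2)[OF i] step(1)[OF i]] f1_a[OF i] up down' i
          by (metis order_antisym)
        then show ?thesis by blast
      qed
    next
      assume down: "\<forall>i\<in>{1..<k}. g 1 (x (i + 1)) \<le> g 1 (x i)"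
      from m2 show ?thesis
      proof
        assume up': "\<forall>i\<in>{1..<k}. g (Suc d) (x i) \<le> g (Suc d) (x (i + 1))"
        have "a i = a (i + 1)" if i: "i \<in> {1..<k}" for i
          using fst_mono[OF d1 step(2)[OF i] step(1)[OF i]] fst_mono'[OF step[OF i]] f1_a[OF i] down up' i
          by (metis order_antisym)
        then show ?thesis by blast
      next
        assume down': "\<forall>i\<in>{1..<k}. g (Suc d) (x (i + 1)) \<le> g (Suc d) (x i)"
        have "a i \<noteq> a (i + 1)" if i: "i \<in> {1..<k}" for i
          using snd_mono[OF d1, of "i + 1" i] snd_mono'[OF step(2)[OF i] step(1)[OF i]] f1_b[OF i] down down' i
          by (metis order_antisym)
        then show ?thesis by blast
      qed
    qed
    then show "k \<le> q"
    proof
      \<comment> \<open>The bound for \<open>d\<close> orders now applies to the first components,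
        in the other case to the second ones.\<close>
      assume ane: "\<forall>i\<in>{1..<k}. a i \<noteq> a (i + 1)"
      have "(\<forall>i\<in>{1..<k}. f j (a i) \<le> f j (a (i + 1))) \<or> (\<forall>i\<in>{1..<k}. f j (a (i + 1)) \<le> f j (a i))"
        if j: "j \<in> {1..d}" for j
      proof -
        have "j \<in> {1..Suc d}" using j by simp
        from mono[rule_format, OF this] show ?thesis
          using fst_mono[OF j] step by blast
      qed
      then show ?thesis using short ane ab_lt(1) unfolding short_monotone_def by blast
    next
      assume aeq: "\<forall>i\<in>{1..<k}. a i = a (i + 1)"
      have "(\<forall>i\<in>{1..<k}. f j (b i) \<le> f j (b (i + 1))) \<or> (\<forall>i\<in>{1..<k}. f j (b (i + 1)) \<le> f j (b i))"
        if j: "j \<in> {1..d}" for j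
      proof -
        have "j \<in> {1..Suc d}" using j by simp
        from mono[rule_format, OF this] show ?thesis
          using snd_mono[OF j] aeq by (metis (no_types, lifting))
      qed
      moreover have "\<forall>i\<in>{1..<k}. b i \<noteq> b (i + 1)" using b_ne aeq by blast
      ultimately show ?thesis using short ab_lt(2) unfolding short_monotone_def by blast
    qed
  qed
  ultimately show ?case by blast
qed

lemma linear_order_on_key:
  assumes "inj_on (f :: 'a \<Rightarrow> nat) V"
  shows "linear_order_on V {(x, y). x \<in> V \<and> y \<in> V \<and> f x \<le> f y}"
  using assms
  unfolding linear_order_on_def partial_order_on_def preorder_on_def
  by (auto simp: refl_on_def trans_def antisym_def total_on_def inj_on_def)

section \<open>A cover by caps\<close>

text \<open>A cap is antipodal-free as \<open>c > 0\<close>. If \<open>u\<close> and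
  \<open>- u\<close> both lay in \<open>rest\<close>, all coordinates would be at most
  \<open>c\<close> in absolute value, too small for a unit vector.\<close>

lemma ex_n_cover_card: "\<exists>\<F>. n_cover n \<F> \<and> card \<F> \<le> n + 2"
proof -
  let ?S = "topspace (nsphere n)"
  \<comment> \<open>Chosen so that \<open>(n + 1) * c\<^sup>2 < 1\<close>.\<close>
  define c where "c = 1 / (real n + 2)"
  have c0: "c > 0" by (simp add: c_def)
  define cap where "cap = (\<lambda>i. {u \<in> ?S. c \<le> u i})"
  define rest where "rest = {u \<in> ?S. \<forall>i\<le>n. u i \<le> c}"
  define \<F> where "\<F> = insert rest (cap ` {..n})"
  have closed_cap: "closedin (nsphere n) (cap i)" for i
    unfolding cap_def using closedin_continuous_map_preimage[OF continuous_map_nsphere_projection, of "{c..}" n i]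
    by simp
  have closed_le: "closedin (nsphere n) {u \<in> ?S. u i \<le> c}" for i
    using closedin_continuous_map_preimage[OF continuous_map_nsphere_projection, of "{..c}" n i] by simp
  have "rest = (\<Inter>i\<in>{..n}. {u \<in> ?S. u i \<le> c})" by (auto simp: rest_def)
  then have closed_rest: "closedin (nsphere n) rest"
    using closed_le by (auto intro!: closedin_INT)
  have "antipodal_free (cap i)" for i
    using c0 by (auto simp: antipodal_free_def cap_def)
  moreover have "antipodal_free rest"
  proof (rule ccontr)
    assume "\<not> ?thesis"
    then obtain u where u: "u \<in> rest" "- u \<in> rest" by (auto simp: antipodal_free_def)
    have "(u i)\<^sup>2 \<le> c\<^sup>2" if "i \<le> n" for i
    proof -
      have "\<bar>u i\<bar> \<le> \<bar>c\<bar>" using u that by (force simp: rest_def abs_le_iff)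
      then show ?thesis by (simp only: abs_le_square_iff)
    qed
    then have "(\<Sum>i\<le>n. (u i)\<^sup>2) \<le> (\<Sum>i\<le>n. c\<^sup>2)" by (intro sum_mono) auto
    also have "\<dots> = ((real n + 1) * c) * c" by (simp add: power2_eq_square)
    also have "\<dots> < 1 * 1" by (rule mult_strict_mono) (use c0 in \<open>simp_all add: c_def\<close>)
    finally show False using u(1) by (simp add: rest_def topspace_nsphere)
  qed
  moreover have "\<Union>\<F> = ?S"
  proof
    show "?S \<subseteq> \<Union>\<F>"
    proof
      fix u assume u: "u \<in> ?S"
      show "u \<in> \<Union>\<F>"
      proof (cases "\<exists>i\<le>n. c \<le> u i")
        case False
        then have "u i \<le> c" if "i \<le> n" for i using that by force
        then have "u \<in> rest" using u by (simp add: rest_def)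
        then show ?thesis by (simp add: \<F>_def)
      qed (use u in \<open>auto simp: \<F>_def cap_def\<close>)
    qed
  qed (auto simp: \<F>_def cap_def rest_def)
  ultimately have "n_cover n \<F>"
    using closed_cap closed_rest by (auto simp: n_cover_def \<F>_def)
  moreover have "card \<F> \<le> n + 2"
    using card_insert_le_m1[of "n + 2" "cap ` {..n}" rest] card_image_le[of "{..n}" cap]
    by (simp add: \<F>_def)
  ultimately show ?thesis by blast
qed

text \<open>Of two neighbours one contains \<open>u\<close> and the other \<open>- u\<close>; an
  antipodal-free set cannot contain both.\<close>

lemma alternating_at_neq:
  assumes "alternating_at u k F" "i \<in> {1..<k}" "antipodal_free (F i)"
  shows "F i \<noteq> F (i + 1)"
proof
  assume eq: "F i = F (i + 1)"
  have i: "i \<in> {1..k}" "i + 1 \<in> {1..k}" "even (i - 1) \<longleftrightarrow> odd i" using assms(2) by auto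
  have "u \<in> F i \<and> - u \<in> F (i + 1) \<or> - u \<in> F i \<and> u \<in> F (i + 1)"
    using assms(1) i(1,2) i(3) unfolding alternating_at_def in_signed_alternating
    by (metis add_diff_cancel_right' even_add odd_one)
  then have u: "u \<in> F i" "- u \<in> F i" using eq by auto
  have "u \<in> uminus ` F i" using u(2) by (metis imageI uminus_uminus_fun)
  then show False using u(1) assms(3) unfolding antipodal_free_def by blast
qed

text \<open>The cover is injected into \<open>{..<q ^ M}\<close> and the keys are pulled back;
  alternation supplies distinct neighbours, so patterns have at most \<open>q\<close>
  members.\<close>

theorem ex_cover_short_monotone_alternating:
  assumes d: "d \<ge> 1"
  shows "\<exists>\<F> (r :: nat \<Rightarrow> (nat \<Rightarrow> real) set rel).
            n_cover n \<F> \<and> (\<forall>j\<in>{1..d}. linear_order_on \<F> (r j)) \<and>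
            (\<forall>u\<in>topspace (nsphere n). \<forall>(k :: nat) F.
               k \<ge> 1 \<and> (\<forall>i\<in>{1..k}. F i \<in> \<F>) \<and> alternating_at u k F \<and>
               (\<forall>j\<in>{1..d}. monotone_wrt (r j) k F) \<longrightarrow>
               int k \<le> \<lceil>(real n + 2) powr (1 / 2 ^ (d - 1))\<rceil>)"
proof -
  define M where "M = (2 :: nat) ^ (d - 1)"
  define c where "c = (real n + 2) powr (1 / real M)"
  \<comment> \<open>The least \<open>q\<close> for which \<open>q ^ M\<close> codes suffice for
    \<open>n + 2\<close> members.\<close>
  define q where "q = nat \<lceil>c\<rceil>"
  have c0: "c > 0" by (simp add: c_def)
  have "real n + 2 = c powr real M" by (simp add: c_def powr_powr M_def)
  also have "\<dots> = c ^ M" using c0 by (simp add: powr_realpow)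
  also have "\<dots> \<le> real q ^ M" using c0 unfolding q_def by (intro power_mono) linarith+
  finally have "real (n + 2) \<le> real (q ^ M)" by simp
  then have nq: "n + 2 \<le> q ^ M" by (simp only: of_nat_le_iff)
  obtain \<F> where cover: "n_cover n \<F>" "card \<F> \<le> n + 2" using ex_n_cover_card by blast
  have fin: "finite \<F>" using cover(1) by (simp add: n_cover_def)
  obtain e where e: "inj_on e \<F>" "e ` \<F> \<subseteq> {..<q ^ M}"
    using card_le_inj[OF fin, of "{..<q ^ M}"] cover(2) nq by auto
  from ex_short_monotone[OF d, of "q ^ M" q] obtain f
    where f': "\<forall>j\<in>{1..d}. inj_on (f j) {..<q ^ M} \<and> f j ` {..<q ^ M} \<subseteq> {..<q ^ M}"
      and short: "short_monotone d (q ^ M) q f"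
    unfolding M_def by blast
  have f: "inj_on (f j) {..<q ^ M}" if "j \<in> {1..d}" for j using f' that by blast
  define r where "r = (\<lambda>j. {(x, y). x \<in> \<F> \<and> y \<in> \<F> \<and> f j (e x) \<le> f j (e y)})"
  have "linear_order_on \<F> (r j)" if "j \<in> {1..d}" for j
  proof -
    have "inj_on (\<lambda>x. f j (e x)) \<F>"
      using comp_inj_on[OF e(1) inj_on_subset[OF f[OF that] e(2)]] by (simp add: comp_def)
    then show ?thesis unfolding r_def by (rule linear_order_on_key)
  qed
  moreover have "int k \<le> \<lceil>c\<rceil>"
    if F: "\<forall>i\<in>{1..k}. F i \<in> \<F>" and alt: "alternating_at u k F"
      and mono: "\<forall>j\<in>{1..d}. monotone_wrt (r j) k F" for u k F
  proof -
    have "\<forall>i\<in>{1..k}. e (F i) < q ^ M" using F e(2) by blast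
    moreover have "\<forall>i\<in>{1..<k}. e (F i) \<noteq> e (F (i + 1))"
    proof
      fix i assume i: "i \<in> {1..<k}"
      then have Fi: "F i \<in> \<F>" "F (i + 1) \<in> \<F>" using F by auto
      then have "antipodal_free (F i)" using cover(1) by (simp add: n_cover_def)
      from alternating_at_neq[OF alt i this] show "e (F i) \<noteq> e (F (i + 1))"
        using Fi e(1) by (auto dest: inj_onD)
    qed
    moreover have "\<forall>j\<in>{1..d}. (\<forall>i\<in>{1..<k}. f j (e (F i)) \<le> f j (e (F (i + 1)))) \<or>
                    (\<forall>i\<in>{1..<k}. f j (e (F (i + 1))) \<le> f j (e (F i)))"
    proof
      fix j assume "j \<in> {1..d}"
      then have "monotone_wrt (r j) k F" using mono by blast
      then show "(\<forall>i\<in>{1..<k}. f j (e (F i)) \<le> f j (e (F (i + 1)))) \<or>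
          (\<forall>i\<in>{1..<k}. f j (e (F (i + 1))) \<le> f j (e (F i)))"
        unfolding monotone_wrt_def r_def by (elim disjE) auto
    qed
    ultimately have "k \<le> q"
      using short[unfolded short_monotone_def, rule_format, of k "\<lambda>i. e (F i)"] by blast
    then show ?thesis using c0 unfolding q_def by linarith
  qed
  ultimately show ?thesis
    using cover(1) unfolding c_def M_def by (intro exI[of _ \<F>] exI[of _ r]) auto
qed

theorem theorem3:
  fixes n d :: nat
  assumes "d \<ge> 1"
  shows "(\<forall>(\<F> :: (nat \<Rightarrow> real) set set) (r :: nat \<Rightarrow> (nat \<Rightarrow> real) set rel).
            n_cover n \<F> \<and> (\<forall>j\<in>{1..d}. linear_order_on \<F> (r j)) \<longrightarrow>
            (\<exists>u\<in>topspace (nsphere n). \<exists>(k :: nat) F.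
               real k \<ge> ((real n + 1) / 2) powr (1 / 2 ^ (d - 1)) \<and>
               (\<forall>i\<in>{1..k}. F i \<in> \<F>) \<and>
               alternating_at u k F \<and>
               (\<forall>j\<in>{1..d}. monotone_wrt (r j) k F)))
       \<and> (\<exists>(\<F> :: (nat \<Rightarrow> real) set set) (r :: nat \<Rightarrow> (nat \<Rightarrow> real) set rel).
            n_cover n \<F> \<and> (\<forall>j\<in>{1..d}. linear_order_on \<F> (r j)) \<and>
            (\<forall>u\<in>topspace (nsphere n). \<forall>(k :: nat) F.
               k \<ge> 1 \<and>
               (\<forall>i\<in>{1..k}. F i \<in> \<F>) \<and>
               alternating_at u k F \<and>
               (\<forall>j\<in>{1..d}. monotone_wrt (r j) k F) \<longrightarrow>
               int k \<le> \<lceil>(real n + 2) powr (1 / 2 ^ (d - 1))\<rceil>))"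
  using ex_monotone_alternating[OF assms] ex_cover_short_monotone_alternating[OF assms] by blast

end
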